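(* Let $(X,\sigma)$ be a minimal subshift over a finite alphabet, with complexity function $P_X$. Suppose there exists a real number $\beta<1/2$ such that $$\limsup_{n\to\infty}\frac{\log(P_X(n))}{n^{\beta}}=0.$$ Then the automorphism group $\mathrm{Aut}(X)$ is amenable (as a countable discrete group). Moreover, every finitely generated, torsion free subgroup of $\mathrm{Aut}(X)$ has subexponential growth.
   Context: Let $\mathcal{A}$ be a finite set with the discrete topology, and give $\mathcal{A}^{\mathbb{Z}}$ the product topology. The left shift $\sigma\colon\mathcal{A}^{\mathbb{Z}}\to\mathcal{A}^{\mathbb{Z}}$ is $\sigma((x_i)_{i\in\mathbb{Z}})=(x_{i+1})_{i\in\mathbb{Z}}$. A subshift $(X,\sigma)$ is a closed, $\sigma$-invariant set $X\subset\mathcal{A}^{\mathbb{Z}}$ with the subspace topology and the restriction of $\sigma$. It is minimal if it is nonempty and the $\sigma$-orbit of every $x\in X$ is dense in $X$. The complexity function is $P_X(n)=$ the number of words $w=w_0\cdots w_{n-1}\in\mathcal{A}^n$ such that some $x\in X$ satisfies $x_i=w_i$ for all $0\le i<n$. $\mathrm{Aut}(X)$ is the group, under composition, of all homeomorphisms $\phi\colon X\to X$ with $\phi\circ\sigma=\sigma\circ\phi$; it is countable and is regarded as a discrete group. A countable discrete group $G$ is amenable if there is a sequence $(F_k)_{k\in\mathbb{N}}$ of finite (nonempty) subsets of $G$ such that for every $g\in G$: $g\in F_k$ for all but finitely many $k$, and $\lim_{k\to\infty}|F_k\triangle gF_k|/|F_k|=0$. For a finitely generated group $G$ with finite symmetric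 (closed under inverses) generating set $\mathcal{S}$, $\gamma_G^{\mathcal{S}}(n)$ is the number of distinct elements of $G$ that can be written as a product of at most $n$ elements of $\mathcal{S}$. $G$ has subexponential growth if $\lim_{n\to\infty}\frac{\log\gamma_G^{\mathcal{S}}(n)}{n}=0$ for some (equivalently, every) finite symmetric generating set $\mathcal{S}$. *)

theory Defs
  imports "HOL-Analysis.Analysis" "HOL-Algebra.Bij" "HOL-Algebra.Coset"
    "HOL-Algebra.Generated_Groups"
begin

section \<open>Subshifts\<close>

definition full_shift :: "'a set \<Rightarrow> (int \<Rightarrow> 'a) topology" where
  "full_shift A = product_topology (\<lambda>_. discrete_topology A) UNIV"

definition shift :: "(int \<Rightarrow> 'a) \<Rightarrow> (int \<Rightarrow> 'a)" where
  "shift x = (\<lambda>i. x (i + 1))"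

text \<open>Invariance of a subshift means that the shift maps it onto itself.\<close>

definition subshift :: "'a set \<Rightarrow> (int \<Rightarrow> 'a) set \<Rightarrow> bool" where
  "subshift A X \<longleftrightarrow> finite A \<and> closedin (full_shift A) X \<and> shift ` X = X"

abbreviation subshift_topology :: "'a set \<Rightarrow> (int \<Rightarrow> 'a) set \<Rightarrow> (int \<Rightarrow> 'a) topology" where
  "subshift_topology A X \<equiv> subtopology (full_shift A) X"

text \<open>The two-sided orbit: the integer \<open>n\<close> ranges over all iterates of the shift and of its
  inverse.\<close>

definition shift_orbit :: "(int \<Rightarrow> 'a) \<Rightarrow> (int \<Rightarrow> 'a) set" where
  "shift_orbit x = range (\<lambda>n i. x (i + n))"

definition minimal_subshift :: "'a set \<Rightarrow> (int \<Rightarrow> 'a) set \<Rightarrow> bool" where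
  "minimal_subshift A X \<longleftrightarrow>
     subshift A X \<and> X \<noteq> {} \<and>
     (\<forall>x\<in>X. subshift_topology A X closure_of shift_orbit x = X)"

definition complexity :: "(int \<Rightarrow> 'a) set \<Rightarrow> nat \<Rightarrow> nat" where
  "complexity X n =
     card {w :: 'a list. length w = n \<and> (\<exists>x\<in>X. \<forall>i<n. x (int i) = w ! i)}"

section \<open>The automorphism group\<close>

text \<open>As for \<^const>\<open>Bij\<close>, maps are taken extensional, so that each automorphism of \<open>X\<close> is
  represented by exactly one function.\<close>

definition shift_automorphisms ::
    "'a set \<Rightarrow> (int \<Rightarrow> 'a) set \<Rightarrow> ((int \<Rightarrow> 'a) \<Rightarrow> (int \<Rightarrow> 'a)) set" where
  "shift_automorphisms A X =
     {\<phi> \<in> extensional X.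
        homeomorphic_map (subshift_topology A X) (subshift_topology A X) \<phi> \<and>
        (\<forall>x\<in>X. \<phi> (shift x) = shift (\<phi> x))}"

definition Aut :: "'a set \<Rightarrow> (int \<Rightarrow> 'a) set \<Rightarrow> ((int \<Rightarrow> 'a) \<Rightarrow> (int \<Rightarrow> 'a)) monoid" where
  "Aut A X = BijGroup X \<lparr>carrier := shift_automorphisms A X\<rparr>"

lemma subgroup_shift_automorphisms:
  assumes "subshift A X"
  shows "subgroup (shift_automorphisms A X) (BijGroup X)"
proof -
  let ?T = "subshift_topology A X"
  have top: "topspace ?T = X" and sh: "\<And>x. x \<in> X \<Longrightarrow> shift x \<in> X"
    using assms closedin_subset by (auto simp: subshift_def)
  have homeo_bij: "bij_betw f X X" if "homeomorphic_map ?T ?T f" for f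
    using that unfolding homeomorphic_eq_everything_map top bij_betw_def by blast
  have sub: "shift_automorphisms A X \<subseteq> Bij X"
    using homeo_bij by (auto simp: shift_automorphisms_def Bij_def)
  show ?thesis
  proof (rule group.subgroupI[OF group_BijGroup])
    show "shift_automorphisms A X \<subseteq> carrier (BijGroup X)"
      using sub by (simp add: BijGroup_def)
    have "(\<lambda>x\<in>X. x) \<in> shift_automorphisms A X"
    proof -
      have "homeomorphic_map ?T ?T id" by simp
      then have "homeomorphic_map ?T ?T (\<lambda>x\<in>X. x)"
        by (rule homeomorphic_map_eq) (simp only: top, simp)
      then show ?thesis by (simp add: shift_automorphisms_def sh)
    qed
    then show "shift_automorphisms A X \<noteq> {}" by blast
  next
    fix f assume f: "f \<in> shift_automorphisms A X"
    let ?g = "\<lambda>x\<in>X. inv_into X f x"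
    have fB: "f \<in> Bij X" using f sub by blast
    then have bij: "bij_betw f X X" by (simp add: Bij_def)
    have hf: "homeomorphic_map ?T ?T f" and cf: "\<And>x. x \<in> X \<Longrightarrow> f (shift x) = shift (f x)"
      using f by (auto simp: shift_automorphisms_def)
    obtain g where g: "homeomorphic_maps ?T ?T f g"
      using hf homeomorphic_map_maps by blast
    have gX: "g y \<in> X" "f (g y) = y" if "y \<in> X" for y
      using g that unfolding homeomorphic_maps_def continuous_map_def top by auto
    have gi: "g y = inv_into X f y" if "y \<in> X" for y
      using bij gX[OF that] by (metis bij_betw_inv_into_left)
    have "homeomorphic_map ?T ?T g" using g homeomorphic_maps_map by blast
    then have "homeomorphic_map ?T ?T ?g"
      by (rule homeomorphic_map_eq) (simp only: top, simp add: gi)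
    moreover have "?g (shift y) = shift (?g y)" if "y \<in> X" for y
    proof -
      have "f (shift (g y)) = shift y" using cf gX that by metis
      then have "inv_into X f (shift y) = shift (g y)"
        using bij sh gX that by (metis bij_betw_inv_into_left)
      then show ?thesis using gi that sh by simp
    qed
    ultimately have "?g \<in> shift_automorphisms A X"
      by (auto simp: shift_automorphisms_def)
    then show "inv\<^bsub>BijGroup X\<^esub> f \<in> shift_automorphisms A X"
      using inv_BijGroup[OF fB] by simp
  next
    fix f g assume f: "f \<in> shift_automorphisms A X" and g: "g \<in> shift_automorphisms A X"
    have fg: "f \<in> Bij X" "g \<in> Bij X" using f g sub by auto
    have gX: "\<And>x. x \<in> X \<Longrightarrow> g x \<in> X" using fg by (auto simp: Bij_def bij_betw_def)
    have "homeomorphic_map ?T ?T (f \<circ> g)"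
      using f g homeomorphic_map_compose by (auto simp: shift_automorphisms_def)
    then have "homeomorphic_map ?T ?T (compose X f g)"
      by (rule homeomorphic_map_eq) (simp only: top, simp add: compose_def)
    then have "compose X f g \<in> shift_automorphisms A X"
      using f g gX sh by (auto simp: shift_automorphisms_def compose_def)
    then show "f \<otimes>\<^bsub>BijGroup X\<^esub> g \<in> shift_automorphisms A X"
      using fg by (simp add: BijGroup_def)
  qed
qed

lemma group_Aut: "subshift A X \<Longrightarrow> group (Aut A X)"
  unfolding Aut_def
  by (rule subgroup.subgroup_is_group[OF subgroup_shift_automorphisms group_BijGroup])

section \<open>Amenability and growth of groups\<close>

definition amenable :: "('g, 'b) monoid_scheme \<Rightarrow> bool" where
  "amenable G \<longleftrightarrow> group G \<and> countable (carrier G) \<and>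
     (\<exists>F :: nat \<Rightarrow> 'g set.
        (\<forall>k. finite (F k) \<and> F k \<noteq> {} \<and> F k \<subseteq> carrier G) \<and>
        (\<forall>g\<in>carrier G.
           (\<forall>\<^sub>F k in sequentially. g \<in> F k) \<and>
           (\<lambda>k. real (card (sym_diff (F k) (g <#\<^bsub>G\<^esub> F k))) / real (card (F k)))
             \<longlonglongrightarrow> 0))"

definition finitely_generated :: "('g, 'b) monoid_scheme \<Rightarrow> bool" where
  "finitely_generated G \<longleftrightarrow>
     (\<exists>S. finite S \<and> S \<subseteq> carrier G \<and> generate G S = carrier G)"

definition torsion_free :: "('g, 'b) monoid_scheme \<Rightarrow> bool" where
  "torsion_free G \<longleftrightarrow>
     (\<forall>g\<in>carrier G. \<forall>n::nat. n > 0 \<longrightarrow> g [^]\<^bsub>G\<^esub> n = \<one>\<^bsub>G\<^esub> \<longrightarrow> g = \<one>\<^bsub>G\<^esub>)"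

definition symmetric_generating_set :: "('g, 'b) monoid_scheme \<Rightarrow> 'g set \<Rightarrow> bool" where
  "symmetric_generating_set G S \<longleftrightarrow>
     S \<subseteq> carrier G \<and> (\<forall>s\<in>S. inv\<^bsub>G\<^esub> s \<in> S) \<and> generate G S = carrier G"

text \<open>The empty product counts as a product of at most \<open>n\<close> elements.\<close>

definition growth :: "('g, 'b) monoid_scheme \<Rightarrow> 'g set \<Rightarrow> nat \<Rightarrow> nat" where
  "growth G S n =
     card {foldr (\<otimes>\<^bsub>G\<^esub>) ss \<one>\<^bsub>G\<^esub> | ss. set ss \<subseteq> S \<and> length ss \<le> n}"

definition subexponential_growth :: "('g, 'b) monoid_scheme \<Rightarrow> bool" where
  "subexponential_growth G \<longleftrightarrow>
     (\<exists>S. finite S \<and> symmetric_generating_set G S \<and>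
          (\<lambda>n. ln (real (growth G S n)) / real n) \<longlonglongrightarrow> 0)"

end

theory Submission
  imports Defs "HOL-Algebra.Multiplicative_Group"
begin

text \<open>
  Write \<open>P\<close> for the complexity function.  The hypothesis implies that \<open>ln (P n)\<close> is
  \<open>o(sqrt n)\<close>.  The idea is to find, for each \<open>N\<close>, a word whose images under a product of
  \<open>N\<close> generators almost determine the product, while the number of words that can be such images is
  subexponential in \<open>N\<close>.

  Say that a word of length \<open>n\<close> is forced up to distance \<open>k\<close> if it has only one extension by \<open>k\<close>
  symbols on both sides.  If there is no such word, then \<open>P (n + 2 * k) \<ge> 2 * P n\<close>.  This cannot happen
  for all of \<open>n = 0, 2 * k, \<dots>, 2 * k * (2 * k - 1)\<close>, because \<open>P (4 * k\<^sup>2)\<close> would be at least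
  \<open>2 ^ (2 * k)\<close>.  So for large \<open>k\<close> some word \<open>w\<close> of length at most \<open>4 * k\<^sup>2\<close> is forced up to distance
  \<open>k\<close>, and \<open>ln (P (4 * k\<^sup>2)) = o(k)\<close>.

  Automorphisms are block codes of finite range.  Let \<open>\<phi>\<close> and \<open>\<psi>\<close> and their inverses have range at
  most \<open>r\<close>, where \<open>2 * r \<le> k\<close>.  If \<open>\<phi>\<close> and \<open>\<psi>\<close> have the same image on the forced extension of \<open>w\<close>,
  then \<open>\<phi>\<inverse> \<psi>\<close> preserves the set of positions at which \<open>w\<close> occurs in a point.  By minimality the
  gaps between these positions are bounded, so there are only finitely many return words to \<open>w\<close>.
  Because \<open>w\<close> is forced, \<open>\<phi>\<inverse> \<psi>\<close> acts by permuting the return words, and the automorphisms that act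
  in this way form a finite group \<open>H\<close> (lemmas \<open>subgroup_occurrence_stabilizer\<close>,
  \<open>finite_occurrence_stabilizer\<close> and \<open>in_occurrence_stabilizer\<close>).  Hence the automorphisms of range
  \<open>r\<close> with inverse of range \<open>r\<close> lie in at most \<open>P (4 * k\<^sup>2)\<close> cosets of \<open>H\<close>
  (\<open>card_cosets_le_complexity\<close>).  Taking for \<open>r\<close> the range of products of \<open>N\<close> generators,
  which is linear in \<open>N\<close>, and \<open>k = 2 * r\<close>, the number of cosets is \<open>exp (o(N))\<close>
  (\<open>subexponential_modulo_finite_Aut\<close>).

  The rest is group theory.  In a torsion-free subgroup, distinct elements lie in distinct cosets
  of a finite \<open>H\<close>, so the growth is subexponential.  In general the balls multiplied by \<open>H\<close> have
  cardinality \<open>card H\<close> times the number of cosets, so that at some radius below \<open>N\<close> the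
  cardinality increases by a factor close to \<open>1\<close>, which gives a Folner set
  (\<open>exists_almost_invariant_set\<close>).
\<close>

section \<open>Groups of subexponential growth modulo finite subgroups\<close>

definition word_ball :: "('g, 'b) monoid_scheme \<Rightarrow> 'g set \<Rightarrow> nat \<Rightarrow> 'g set" where
  "word_ball G S n = {foldr (\<otimes>\<^bsub>G\<^esub>) ss \<one>\<^bsub>G\<^esub> | ss. set ss \<subseteq> S \<and> length ss \<le> n}"

definition ball_cosets :: "('g, 'b) monoid_scheme \<Rightarrow> 'g set \<Rightarrow> nat \<Rightarrow> 'g set \<Rightarrow> 'g set set" where
  "ball_cosets G S n H = (\<lambda>g. g <#\<^bsub>G\<^esub> H) ` word_ball G S n"

text \<open>The finite subgroup may change with the radius \<open>n\<close>.  As it need not be normal, the cosets do not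
  form a quotient group whose growth could be measured instead.\<close>

definition subexponential_modulo_finite :: "('g, 'b) monoid_scheme \<Rightarrow> bool" where
  "subexponential_modulo_finite G \<longleftrightarrow>
     (\<forall>S \<epsilon>. finite S \<longrightarrow> S \<subseteq> carrier G \<longrightarrow> \<epsilon> > (0::real) \<longrightarrow>
        (\<forall>\<^sub>F n in sequentially. \<exists>H. subgroup H G \<and> finite H \<and>
           real (card (ball_cosets G S n H)) \<le> exp (\<epsilon> * real n)))"

lemma finite_word_ball: "finite S \<Longrightarrow> finite (word_ball G S n)"
proof -
  assume "finite S"
  then have "finite {ss. set ss \<subseteq> S \<and> length ss \<le> n}"
    by (rule finite_lists_length_le)
  moreover have "word_ball G S n = (\<lambda>ss. foldr (\<otimes>\<^bsub>G\<^esub>) ss \<one>\<^bsub>G\<^esub>) ` {ss. set ss \<subseteq> S \<and> length ss \<le> n}"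
    unfolding word_ball_def by auto
  ultimately show ?thesis by simp
qed

lemma word_ball_mono: "m \<le> n \<Longrightarrow> word_ball G S m \<subseteq> word_ball G S n"
  unfolding word_ball_def by fastforce

lemma one_in_word_ball: "\<one>\<^bsub>G\<^esub> \<in> word_ball G S n"
  unfolding word_ball_def by (auto intro: exI[of _ "[]"])

lemma mult_in_word_ball: "s \<in> S \<Longrightarrow> g \<in> word_ball G S n \<Longrightarrow> s \<otimes>\<^bsub>G\<^esub> g \<in> word_ball G S (Suc n)"
proof -
  assume s: "s \<in> S" and "g \<in> word_ball G S n"
  then obtain ss where "g = foldr (\<otimes>\<^bsub>G\<^esub>) ss \<one>\<^bsub>G\<^esub>" "set ss \<subseteq> S" "length ss \<le> n"
    unfolding word_ball_def by blast
  then show ?thesis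
    using s unfolding word_ball_def by (auto intro!: exI[of _ "s # ss"])
qed

text \<open>The rule for proving a property that weakens by one step with each factor, such as a bound on
  the range of an automorphism.\<close>

lemma word_ball_induct [consumes 1, case_names one mult]:
  assumes "g \<in> word_ball G S n"
    and "\<And>n. P n \<one>\<^bsub>G\<^esub>"
    and "\<And>n s g. s \<in> S \<Longrightarrow> P n g \<Longrightarrow> P (Suc n) (s \<otimes>\<^bsub>G\<^esub> g)"
  shows "P n g"
proof -
  have "P n (foldr (\<otimes>\<^bsub>G\<^esub>) ss \<one>\<^bsub>G\<^esub>)" if "set ss \<subseteq> S" "length ss \<le> n" for ss n
    using that
  proof (induction ss arbitrary: n)
    case Nil
    then show ?case using assms(2) by simp
  next
    case (Cons s ss)
    then obtain m where "n = Suc m" "length ss \<le> m" by (cases n) auto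
    with Cons assms(3) show ?case by simp
  qed
  then show ?thesis using assms(1) unfolding word_ball_def by blast
qed

lemma growth_eq_card_word_ball: "growth G S n = card (word_ball G S n)"
  unfolding growth_def word_ball_def ..

lemma word_ball_carrier_update: "word_ball (G\<lparr>carrier := K\<rparr>) S n = word_ball G S n"
  unfolding word_ball_def by simp

context group
begin

lemma word_ball_subset: "S \<subseteq> carrier G \<Longrightarrow> word_ball G S n \<subseteq> carrier G"
proof
  fix g assume S: "S \<subseteq> carrier G" and "g \<in> word_ball G S n"
  from this(2) show "g \<in> carrier G"
    by (induction rule: word_ball_induct) (use S in auto)
qed

lemma generators_in_word_ball:
  assumes "S \<subseteq> carrier G" "n > 0" shows "S \<subseteq> word_ball G S n"
proof
  fix s assume s: "s \<in> S"
  have "s \<otimes> \<one> \<in> word_ball G S (Suc 0)"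
    using mult_in_word_ball[OF s one_in_word_ball] .
  then show "s \<in> word_ball G S n"
    using s assms word_ball_mono[of "Suc 0" n G S] by (auto simp: subset_iff)
qed

lemma l_coset_eq_iff:
  assumes H: "subgroup H G" and g: "g \<in> carrier G" and h: "h \<in> carrier G"
  shows "g <#\<^bsub>G\<^esub> H = h <#\<^bsub>G\<^esub> H \<longleftrightarrow> inv g \<otimes> h \<in> H"
proof
  assume "g <#\<^bsub>G\<^esub> H = h <#\<^bsub>G\<^esub> H"
  moreover have "h \<in> h <#\<^bsub>G\<^esub> H"
    using h subgroup.one_closed[OF H] unfolding l_coset_def by force
  ultimately obtain k where "k \<in> H" "h = g \<otimes> k" unfolding l_coset_def by blast
  then show "inv g \<otimes> h \<in> H"
    using g subgroup.mem_carrier[OF H] by (simp add: m_assoc[symmetric])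
next
  assume "inv g \<otimes> h \<in> H"
  moreover have "h = g \<otimes> (inv g \<otimes> h)" using g h by (simp add: m_assoc[symmetric])
  ultimately have "h \<in> g <#\<^bsub>G\<^esub> H" unfolding l_coset_def by blast
  then show "g <#\<^bsub>G\<^esub> H = h <#\<^bsub>G\<^esub> H" using l_repr_independence[OF _ g H] by blast
qed

lemma card_l_coset:
  assumes "subgroup H G" "g \<in> carrier G" shows "card (g <#\<^bsub>G\<^esub> H) = card H"
proof -
  have "g <#\<^bsub>G\<^esub> H = (\<lambda>h. g \<otimes> h) ` H" unfolding l_coset_def by auto
  moreover have "inj_on (\<lambda>h. g \<otimes> h) H"
    using assms using subgroup.mem_carrier[OF assms(1)] by (auto intro!: inj_onI)
  ultimately show ?thesis by (simp add: card_image)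
qed

lemma card_Union_l_cosets:
  assumes H: "subgroup H G" "finite H" and B: "finite B" "B \<subseteq> carrier G"
  shows "finite (\<Union>((\<lambda>g. g <#\<^bsub>G\<^esub> H) ` B))"
    and "card (\<Union>((\<lambda>g. g <#\<^bsub>G\<^esub> H) ` B)) = card H * card ((\<lambda>g. g <#\<^bsub>G\<^esub> H) ` B)"
proof -
  have fin: "finite (g <#\<^bsub>G\<^esub> H)" for g
    using H(2) by (simp add: l_coset_def)
  show *: "finite (\<Union>((\<lambda>g. g <#\<^bsub>G\<^esub> H) ` B))" using B(1) fin by auto
  have "card H * card ((\<lambda>g. g <#\<^bsub>G\<^esub> H) ` B) = card (\<Union>((\<lambda>g. g <#\<^bsub>G\<^esub> H) ` B))"
  proof (rule card_partition)
    show "c1 \<inter> c2 = {}" if c: "c1 \<in> (\<lambda>g. g <#\<^bsub>G\<^esub> H) ` B" "c2 \<in> (\<lambda>g. g <#\<^bsub>G\<^esub> H) ` B" "c1 \<noteq> c2" for c1 c2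
    proof (rule ccontr)
      assume "c1 \<inter> c2 \<noteq> {}"
      then obtain z where z: "z \<in> c1" "z \<in> c2" by blast
      obtain g h where "c1 = g <#\<^bsub>G\<^esub> H" "c2 = h <#\<^bsub>G\<^esub> H" "g \<in> carrier G" "h \<in> carrier G"
        using c B(2) by blast
      then show False using z c(3) l_repr_independence[OF _ _ H(1)] by metis
    qed
  qed (use B * card_l_coset[OF H(1)] in auto)
  then show "card (\<Union>((\<lambda>g. g <#\<^bsub>G\<^esub> H) ` B)) = card H * card ((\<lambda>g. g <#\<^bsub>G\<^esub> H) ` B)" by simp
qed

end

text \<open>The step starts at radius \<open>1\<close>, not \<open>0\<close>, because the almost invariant set below has to contain
  the generators.\<close>

lemma exists_slow_growth_step:
  fixes c :: "nat \<Rightarrow> real"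
  assumes "\<delta> > 0" "c 1 \<ge> 1" "N \<ge> 1" "c N < (1 + \<delta>) ^ (N - 1)"
  shows "\<exists>j. 1 \<le> j \<and> j < N \<and> c (Suc j) \<le> (1 + \<delta>) * c j"
proof (rule ccontr)
  assume "\<not> ?thesis"
  then have step: "c (Suc j) > (1 + \<delta>) * c j" if "1 \<le> j" "j < N" for j
    using that by force
  have "c (Suc j) \<ge> (1 + \<delta>) ^ j" if "j < N" for j
    using that
  proof (induction j)
    case 0
    then show ?case using assms(2) by simp
  next
    case (Suc j)
    then have "(1 + \<delta>) ^ Suc j \<le> (1 + \<delta>) * c (Suc j)"
      using assms(1) by (simp add: mult_left_mono)
    also have "\<dots> \<le> c (Suc (Suc j))" using step[of "Suc j"] Suc.prems by simp
    finally show ?case .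
  qed
  from this[of "N - 1"] assms(3,4) show False by simp
qed

text \<open>Since the number of cosets \<open>gH\<close> with \<open>g\<close> in the ball of radius \<open>N\<close> is below exponential,
  some earlier step from radius \<open>j\<close> to \<open>j + 1\<close> adds few cosets.  The union \<open>F\<close> of the cosets at
  radius \<open>j\<close> is then almost invariant: \<open>gF\<close> is contained in the union at radius \<open>j + 1\<close>.\<close>

lemma (in group) exists_almost_invariant_set:
  assumes sub: "subexponential_modulo_finite G"
    and S: "finite S" "S \<subseteq> carrier G" and "\<epsilon> > (0::real)"
  shows "\<exists>F. finite F \<and> F \<noteq> {} \<and> F \<subseteq> carrier G \<and> S \<subseteq> F \<and>
    (\<forall>g\<in>S. real (card (sym_diff F (g <#\<^bsub>G\<^esub> F))) \<le> \<epsilon> * real (card F))"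
proof -
  define \<delta> where "\<delta> = \<epsilon> / 2"
  have \<delta>: "\<delta> > 0" using assms by (simp add: \<delta>_def)
  \<comment> \<open>Half of the rate \<open>ln (1 + \<delta>)\<close> leaves room for the exponent \<open>N - 1\<close> in place of \<open>N\<close>.\<close>
  define \<eta> where "\<eta> = ln (1 + \<delta>) / 2"
  have \<eta>: "\<eta> > 0" using \<delta> by (simp add: \<eta>_def)
  have "\<forall>\<^sub>F n in sequentially. \<exists>H. subgroup H G \<and> finite H \<and>
           real (card (ball_cosets G S n H)) \<le> exp (\<eta> * real n)"
    using sub S \<eta> unfolding subexponential_modulo_finite_def by blast
  then obtain N0 where N0: "\<And>n. n \<ge> N0 \<Longrightarrow> \<exists>H. subgroup H G \<and> finite H \<and>
           real (card (ball_cosets G S n H)) \<le> exp (\<eta> * real n)"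
    unfolding eventually_sequentially by blast
  define N where "N = max N0 3"
  have N3: "N \<ge> 3" by (simp add: N_def)
  obtain H where H: "subgroup H G" "finite H"
    and bound: "real (card (ball_cosets G S N H)) \<le> exp (\<eta> * real N)"
    using N0[of N] by (auto simp: N_def)
  define c where "c j = card (ball_cosets G S j H)" for j
  have fin: "finite (ball_cosets G S j H)" for j
    using S finite_word_ball[of S G j] by (simp add: ball_cosets_def)
  have ne: "ball_cosets G S j H \<noteq> {}" for j
    using one_in_word_ball[of G S j] by (auto simp: ball_cosets_def)
  have "c 1 \<ge> 1" using fin[of 1] ne[of 1] by (simp add: c_def Suc_le_eq card_gt_0_iff)
  moreover have "real (c N) < (1 + \<delta>) ^ (N - 1)"
  proof -
    have "real N / 2 < real (N - 1)" using N3 by (simp add: of_nat_diff)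
    then have "ln (1 + \<delta>) * (real N / 2) < ln (1 + \<delta>) * real (N - 1)"
      using \<delta> by (intro mult_strict_left_mono) auto
    then have "exp (\<eta> * real N) < exp (real (N - 1) * ln (1 + \<delta>))"
      by (simp add: \<eta>_def mult.commute)
    also have "\<dots> = (1 + \<delta>) ^ (N - 1)"
      using \<delta> by (simp add: exp_of_nat_mult)
    finally show ?thesis using bound by (simp add: c_def)
  qed
  ultimately obtain j where j: "1 \<le> j" and slow: "real (c (Suc j)) \<le> (1 + \<delta>) * real (c j)"
    using exists_slow_growth_step[of \<delta> "\<lambda>j. real (c j)" N] \<delta> N3 by auto
  define F where "F = \<Union>(ball_cosets G S j H)"
  define F' where "F' = \<Union>(ball_cosets G S (Suc j) H)"
  note B = finite_word_ball[OF S(1)] word_ball_subset[OF S(2)]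
  have finF: "finite F" "finite F'" and cardF: "card F = card H * c j" "card F' = card H * c (Suc j)"
    unfolding F_def F'_def c_def ball_cosets_def
    using card_Union_l_cosets[OF H B(1)[of G j] B(2)[of j]]
       card_Union_l_cosets[OF H B(1)[of G "Suc j"] B(2)[of "Suc j"]] by simp_all
  have ball_F: "word_ball G S j \<subseteq> F"
  proof
    fix g assume g: "g \<in> word_ball G S j"
    then have "g \<in> g <#\<^bsub>G\<^esub> H"
      using B(2) subgroup.one_closed[OF H(1)] unfolding l_coset_def by force
    with g show "g \<in> F" by (auto simp: F_def ball_cosets_def)
  qed
  have "g <#\<^bsub>G\<^esub> H \<subseteq> carrier G" if "g \<in> word_ball G S j" for g
    using l_coset_subset_G[OF subgroup.subset[OF H(1)]] B(2)[of j] that by blast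
  then have FG: "F \<subseteq> carrier G"
    by (auto simp: F_def ball_cosets_def)
  have FF': "F \<subseteq> F'"
    using word_ball_mono[of j "Suc j" G S] by (auto simp: F_def F'_def ball_cosets_def)
  have "real (card (sym_diff F (g <#\<^bsub>G\<^esub> F))) \<le> \<epsilon> * real (card F)" if g: "g \<in> S" for g
  proof -
    have gG: "g \<in> carrier G" using g S by blast
    have card_gF: "card (g <#\<^bsub>G\<^esub> F) = card F"
    proof -
      have "g <#\<^bsub>G\<^esub> F = (\<lambda>x. g \<otimes> x) ` F" unfolding l_coset_def by auto
      moreover have "inj_on (\<lambda>x. g \<otimes> x) F"
        using gG FG by (auto intro!: inj_onI simp: subset_iff)
      ultimately show ?thesis by (simp add: card_image)
    qed
    have fin_gF: "finite (g <#\<^bsub>G\<^esub> F)" using finF(1) by (simp add: l_coset_def)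
    have gF: "g <#\<^bsub>G\<^esub> F \<subseteq> F'"
    proof
      fix y assume "y \<in> g <#\<^bsub>G\<^esub> F"
      then obtain x h where x: "x \<in> word_ball G S j" and h: "h \<in> H" and y: "y = g \<otimes> (x \<otimes> h)"
        unfolding F_def ball_cosets_def l_coset_def by blast
      have "x \<in> carrier G" "h \<in> carrier G" using x h B(2) subgroup.mem_carrier[OF H(1)] by blast+
      then have "y = (g \<otimes> x) \<otimes> h" using y gG by (simp add: m_assoc)
      then have "y \<in> (g \<otimes> x) <#\<^bsub>G\<^esub> H" using h unfolding l_coset_def by blast
      then show "y \<in> F'"
        using mult_in_word_ball[OF g x] unfolding F'_def ball_cosets_def by blast
    qed
    have "card ((g <#\<^bsub>G\<^esub> F) - F) \<le> card (F' - F)"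
      using gF finF(2) by (intro card_mono finite_Diff Diff_mono order_refl)
    also have "\<dots> = card F' - card F"
      using FF' finF by (simp add: card_Diff_subset)
    finally have "card ((g <#\<^bsub>G\<^esub> F) - F) \<le> card F' - card F" .
    moreover have "card F \<le> card F'" using FF' finF by (simp add: card_mono)
    ultimately have "real (card ((g <#\<^bsub>G\<^esub> F) - F)) \<le> real (card F') - real (card F)"
      by linarith
    also have "\<dots> = real (card H) * (real (c (Suc j)) - real (c j))"
      by (simp add: cardF algebra_simps)
    also have "\<dots> \<le> real (card H) * (\<delta> * real (c j))"
      using slow by (intro mult_left_mono) (simp_all add: algebra_simps)
    also have "\<dots> = \<delta> * real (card F)" by (simp add: cardF)
    finally have out: "real (card ((g <#\<^bsub>G\<^esub> F) - F)) \<le> \<delta> * real (card F)" .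
    have "card (F - (g <#\<^bsub>G\<^esub> F)) = card ((g <#\<^bsub>G\<^esub> F) - F)"
      using card_gF card_Diff_subset_Int[of F "g <#\<^bsub>G\<^esub> F"] card_Diff_subset_Int[of "g <#\<^bsub>G\<^esub> F" F]
        finF fin_gF by (simp add: Int_commute)
    moreover have "card (sym_diff F (g <#\<^bsub>G\<^esub> F)) = card (F - (g <#\<^bsub>G\<^esub> F)) + card ((g <#\<^bsub>G\<^esub> F) - F)"
      using finF fin_gF by (intro card_Un_disjoint) auto
    ultimately show ?thesis using out by (simp add: \<delta>_def)
  qed
  moreover have "S \<subseteq> F" using generators_in_word_ball[OF S(2), of j] j ball_F by auto
  moreover have "F \<noteq> {}" using ball_F one_in_word_ball by blast
  ultimately show ?thesis using finF FG by blast
qed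

text \<open>Enumerating the group, the \<open>k\<close>-th set is made \<open>1 / (k + 1)\<close>-invariant under the first \<open>k + 1\<close>
  elements and contains them.\<close>

lemma amenable_if_subexponential_modulo_finite:
  fixes G (structure)
  assumes G: "group G" and count: "countable (carrier G)"
    and sub: "subexponential_modulo_finite G"
  shows "amenable G"
proof -
  interpret group G by fact
  define e where "e = from_nat_into (carrier G)"
  have e: "e i \<in> carrier G" for i
    unfolding e_def using one_closed by (intro from_nat_into) auto
  have "\<exists>F. finite F \<and> F \<noteq> {} \<and> F \<subseteq> carrier G \<and> e ` {..k} \<subseteq> F \<and>
    (\<forall>g\<in>e ` {..k}. real (card (sym_diff F (g <#\<^bsub>G\<^esub> F))) \<le> inverse (real (Suc k)) * real (card F))" for k
    using e by (intro exists_almost_invariant_set[OF sub]) auto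
  then obtain F where F: "\<And>k. finite (F k) \<and> F k \<noteq> {} \<and> F k \<subseteq> carrier G"
    and eF: "\<And>k. e ` {..k} \<subseteq> F k"
    and inv: "\<And>k g. g \<in> e ` {..k} \<Longrightarrow>
       real (card (sym_diff (F k) (g <#\<^bsub>G\<^esub> F k))) \<le> inverse (real (Suc k)) * real (card (F k))"
    by metis
  have "(\<forall>\<^sub>F k in sequentially. g \<in> F k) \<and>
     (\<lambda>k. real (card (sym_diff (F k) (g <#\<^bsub>G\<^esub> F k))) / real (card (F k))) \<longlonglongrightarrow> 0"
    if g: "g \<in> carrier G" for g
  proof -
    obtain i where i: "g = e i"
      using from_nat_into_surj[OF count g] unfolding e_def by blast
    have ev: "\<forall>\<^sub>F k in sequentially. g \<in> e ` {..k}"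
      unfolding i using eventually_ge_at_top[of i] by eventually_elim auto
    have "\<forall>\<^sub>F k in sequentially. g \<in> F k"
      using ev by eventually_elim (use eF in blast)
    moreover have "(\<lambda>k. real (card (sym_diff (F k) (g <#\<^bsub>G\<^esub> F k))) / real (card (F k))) \<longlonglongrightarrow> 0"
    proof (rule tendsto_sandwich[OF _ _ tendsto_const LIMSEQ_inverse_real_of_nat])
      show "\<forall>\<^sub>F k in sequentially. real (card (sym_diff (F k) (g <#\<^bsub>G\<^esub> F k))) / real (card (F k))
          \<le> inverse (real (Suc k))"
        using ev
      proof eventually_elim
        case (elim k)
        have "real (card (F k)) > 0" using F[of k] by (simp add: card_gt_0_iff)
        then show ?case using inv[OF elim] by (simp add: pos_divide_le_eq)
      qed
    qed auto
    ultimately show ?thesis by blast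
  qed
  then show ?thesis
    unfolding amenable_def using G count F by blast
qed

text \<open>A torsion-free subgroup meets every finite subgroup trivially, so distinct elements of it lie
  in distinct cosets of a finite subgroup, and counting cosets means counting elements.\<close>

lemma subexponential_growth_if_torsion_free:
  fixes G (structure)
  assumes G: "group G" and sub: "subexponential_modulo_finite G" and K: "subgroup K G"
    and fg: "finitely_generated (G\<lparr>carrier := K\<rparr>)" and tf: "torsion_free (G\<lparr>carrier := K\<rparr>)"
  shows "subexponential_growth (G\<lparr>carrier := K\<rparr>)"
proof -
  interpret group G by fact
  let ?K = "G\<lparr>carrier := K\<rparr>"
  interpret K: group ?K using subgroup_imp_group[OF K] .
  note KG = subgroup.subset[OF K]
  have invK: "inv\<^bsub>?K\<^esub> g = inv g" if "g \<in> K" for g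
    using m_inv_consistent[OF K that] by simp
  obtain S0 where S0: "finite S0" "S0 \<subseteq> K" "generate ?K S0 = K"
    using fg unfolding finitely_generated_def by auto
  define S where "S = S0 \<union> (\<lambda>g. inv g) ` S0"
  have S: "finite S" "S \<subseteq> K"
    using S0 subgroup.m_inv_closed[OF K] by (auto simp: S_def)
  have sym: "symmetric_generating_set ?K S"
    unfolding symmetric_generating_set_def
  proof (intro conjI ballI)
    show "inv\<^bsub>?K\<^esub> s \<in> S" if "s \<in> S" for s
    proof -
      have "inv (inv t) = t" if "t \<in> S0" for t
        using that S0(2) KG by (simp add: subset_iff)
      then have "inv s \<in> S" using that by (auto simp: S_def)
      then show ?thesis using invK[of s] that S(2) by auto
    qed
    show "generate ?K S = carrier ?K"
    proof
      show "generate ?K S \<subseteq> carrier ?K" using S by (intro K.generate_incl) simp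
      show "carrier ?K \<subseteq> generate ?K S"
        using S0 K.mono_generate[of S0 S] by (auto simp: S_def)
    qed
  qed (use S in simp)
  have fin_ord: "g = \<one>" if H: "subgroup H G" "finite H" and g: "g \<in> H" "g \<in> K" for H g
  proof -
    interpret H: group "G\<lparr>carrier := H\<rparr>" using subgroup_imp_group[OF H(1)] .
    have "g [^]\<^bsub>G\<lparr>carrier := H\<rparr>\<^esub> order (G\<lparr>carrier := H\<rparr>) = \<one>"
      using H.pow_order_eq_1[of g] g(1) by simp
    then have "g [^]\<^bsub>?K\<^esub> order (G\<lparr>carrier := H\<rparr>) = \<one>"
      by (metis nat_pow_consistent)
    moreover have "order (G\<lparr>carrier := H\<rparr>) > 0"
      using H g by (auto simp: order_def card_gt_0_iff)
    ultimately show ?thesis using tf g unfolding torsion_free_def by auto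
  qed
  have lim: "(\<lambda>n. ln (real (growth ?K S n)) / real n) \<longlonglongrightarrow> 0"
  proof (rule LIMSEQ_I)
    fix r :: real assume r: "r > 0"
    have "\<forall>\<^sub>F n in sequentially. \<exists>H. subgroup H G \<and> finite H \<and>
           real (card (ball_cosets G S n H)) \<le> exp (r / 2 * real n)"
      using sub S KG r unfolding subexponential_modulo_finite_def by (meson half_gt_zero subset_trans)
    then have "\<forall>\<^sub>F n in sequentially. norm (ln (real (growth ?K S n)) / real n - 0) < r"
      using eventually_gt_at_top[of 0]
    proof eventually_elim
      case (elim n)
      then obtain H where H: "subgroup H G" "finite H"
        and b: "real (card (ball_cosets G S n H)) \<le> exp (r / 2 * real n)" by blast
      have ball: "word_ball G S n \<subseteq> K"
        using K.word_ball_subset[of S n] S by (simp add: word_ball_carrier_update)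
      have "inj_on (\<lambda>g. g <#\<^bsub>G\<^esub> H) (word_ball G S n)"
      proof (rule inj_onI)
        fix g h assume gh: "g \<in> word_ball G S n" "h \<in> word_ball G S n" "g <#\<^bsub>G\<^esub> H = h <#\<^bsub>G\<^esub> H"
        then have K2: "g \<in> K" "h \<in> K" using ball by auto
        then have G2: "g \<in> carrier G" "h \<in> carrier G" using KG by auto
        have "inv g \<otimes> h \<in> H" using gh(3) l_coset_eq_iff[OF H(1) G2] by simp
        moreover have "inv g \<otimes> h \<in> K"
          using K2 subgroup.m_closed[OF K] subgroup.m_inv_closed[OF K] by simp
        ultimately have "inv g \<otimes> h = \<one>" using fin_ord[OF H] by blast
        then show "g = h" using G2 by (metis inv_equality inv_inv inv_closed)
      qed
      then have "card (ball_cosets G S n H) = growth ?K S n"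
        by (simp add: ball_cosets_def card_image growth_eq_card_word_ball word_ball_carrier_update)
      then have up: "real (growth ?K S n) \<le> exp (r / 2 * real n)" using b by simp
      have "growth ?K S n \<noteq> 0"
        using finite_word_ball[OF S(1), of G n] one_in_word_ball[of G S n]
        by (auto simp: growth_eq_card_word_ball word_ball_carrier_update)
      then have low: "real (growth ?K S n) \<ge> 1" by simp
      have "ln (real (growth ?K S n)) \<le> r / 2 * real n"
        using up low by (metis ln_exp ln_le_cancel_iff exp_gt_zero less_le_trans zero_less_one)
      then have "ln (real (growth ?K S n)) / real n \<le> r / 2"
        using elim by (simp add: pos_divide_le_eq)
      moreover have "ln (real (growth ?K S n)) / real n \<ge> 0" using low by simp
      ultimately show ?case using r by (simp only: real_norm_def diff_zero abs_of_nonneg)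
    qed
    then show "\<exists>no. \<forall>n\<ge>no. norm (ln (real (growth ?K S n)) / real n - 0) < r"
      unfolding eventually_sequentially .
  qed
  show ?thesis
    unfolding subexponential_growth_def using S(1) sym lim by blast
qed

section \<open>Configurations that agree on an interval\<close>

definition agree :: "int \<Rightarrow> int \<Rightarrow> (int \<Rightarrow> 'a) \<Rightarrow> (int \<Rightarrow> 'a) \<Rightarrow> bool" where
  "agree a b x y \<longleftrightarrow> (\<forall>i. a \<le> i \<and> i < b \<longrightarrow> x i = y i)"

definition translate :: "int \<Rightarrow> (int \<Rightarrow> 'a) \<Rightarrow> (int \<Rightarrow> 'a)" where
  "translate n x = (\<lambda>i. x (i + n))"

definition window :: "int \<Rightarrow> nat \<Rightarrow> (int \<Rightarrow> 'a) \<Rightarrow> 'a list" where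
  "window a n x = map (\<lambda>i. x (a + int i)) [0..<n]"

lemma agree_refl: "agree a b x x"
  by (simp add: agree_def)

lemma agree_sym: "agree a b x y \<Longrightarrow> agree a b y x"
  by (simp add: agree_def)

lemma agree_trans: "agree a b x y \<Longrightarrow> agree a b y z \<Longrightarrow> agree a b x z"
  by (simp add: agree_def)

lemma agree_subinterval: "agree a b x y \<Longrightarrow> a \<le> c \<Longrightarrow> d \<le> b \<Longrightarrow> agree c d x y"
  by (simp add: agree_def)

lemma agree_join:
  assumes "agree a b x y" "agree c d x y" "c \<le> b" shows "agree a d x y"
  unfolding agree_def
proof (intro allI impI)
  fix i assume "a \<le> i \<and> i < d"
  then show "x i = y i"
    using assms by (cases "i < b") (auto simp: agree_def)
qed

lemma agree_translate: "agree a b (translate n x) (translate n y) \<longleftrightarrow> agree (a + n) (b + n) x y"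
proof
  assume L: "agree a b (translate n x) (translate n y)"
  show "agree (a + n) (b + n) x y"
    unfolding agree_def
  proof (intro allI impI)
    fix i assume "a + n \<le> i \<and> i < b + n"
    then have "translate n x (i - n) = translate n y (i - n)"
      using L by (auto simp: agree_def)
    then show "x i = y i" by (simp add: translate_def)
  qed
qed (auto simp: agree_def translate_def)

lemma translate_0 [simp]: "translate 0 x = x"
  by (simp add: translate_def)

lemma translate_translate [simp]: "translate m (translate n x) = translate (m + n) x"
  by (simp add: translate_def add.assoc)

lemma shift_eq_translate: "shift x = translate 1 x"
  by (simp add: shift_def translate_def)

lemma length_window [simp]: "length (window a n x) = n"
  by (simp add: window_def)

lemma nth_window: "i < n \<Longrightarrow> window a n x ! i = x (a + int i)"
  by (simp add: window_def)

lemma window_eq_iff_agree: "window a n x = window a n y \<longleftrightarrow> agree a (a + int n) x y"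
proof -
  have "window a n x = window a n y \<longleftrightarrow> (\<forall>i<n. x (a + int i) = y (a + int i))"
    by (auto simp: window_def)
  also have "\<dots> \<longleftrightarrow> agree a (a + int n) x y"
    unfolding agree_def
  proof (intro iffI allI impI)
    fix i assume *: "\<forall>i<n. x (a + int i) = y (a + int i)" and i: "a \<le> i \<and> i < a + int n"
    then have "nat (i - a) < n" "a + int (nat (i - a)) = i" by auto
    with * show "x i = y i" by metis
  qed auto
  finally show ?thesis .
qed

lemma window_translate: "window a n (translate m x) = window (a + m) n x"
  by (simp add: window_def translate_def ac_simps)

section \<open>Compactness of a subshift\<close>

locale subshift_system =
  fixes A :: "'a set" and X :: "(int \<Rightarrow> 'a) set"
  assumes subshift: "subshift A X"
begin

lemma topspace_subshift: "topspace (subshift_topology A X) = X"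
  using subshift closedin_subset by (auto simp: subshift_def)

lemma value_in_alphabet: "x \<in> X \<Longrightarrow> x i \<in> A"
  using subshift closedin_subset[of "full_shift A" X]
  by (auto simp: subshift_def full_shift_def PiE_def)

lemma finite_alphabet: "finite A"
  using subshift by (simp add: subshift_def)

lemma translate_in: "x \<in> X \<Longrightarrow> translate n x \<in> X"
proof (induction n arbitrary: x rule: int_induct[of _ 0])
  case base
  then show ?case by simp
next
  case (step1 i)
  have "shift (translate i x) \<in> X"
    using step1 subshift unfolding subshift_def by blast
  then show ?case by (simp add: shift_eq_translate add.commute)
next
  case (step2 i)
  obtain y where y: "y \<in> X" "translate i x = shift y"
    using step2 subshift unfolding subshift_def by blast
  have "translate (-1) (translate i x) = y" by (simp only: y(2) shift_eq_translate) simp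
  then show ?case using y(1) by simp
qed

lemma window_in_lists: "x \<in> X \<Longrightarrow> window a n x \<in> {w. set w \<subseteq> A \<and> length w = n}"
  using value_in_alphabet by (auto simp: window_def)

lemma finite_window_image: "finite (window a n ` X)"
proof (rule finite_subset)
  show "window a n ` X \<subseteq> {w. set w \<subseteq> A \<and> length w = n}"
    using window_in_lists by (rule image_subsetI)
qed (rule finite_lists_length_eq[OF finite_alphabet])

lemma card_window_image: "card (window a n ` X) = complexity X n"
proof -
  have "window a n ` X = window 0 n ` X"
  proof -
    have "window a n x \<in> window 0 n ` X" if "x \<in> X" for x
      using translate_in[OF that, of a] window_translate[of 0 n a x] by force
    moreover have "window 0 n x \<in> window a n ` X" if "x \<in> X" for x
      using translate_in[OF that, of "-a"] window_translate[of a n "-a" x] by force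
    ultimately show ?thesis by blast
  qed
  also have "\<dots> = {w. length w = n \<and> (\<exists>x\<in>X. \<forall>i<n. x (int i) = w ! i)}"
    by (auto simp: nth_window image_iff list_eq_iff_nth_eq) metis
  finally show ?thesis by (simp add: complexity_def)
qed

lemma complexity_mono: assumes "m \<le> n" shows "complexity X m \<le> complexity X n"
proof -
  have "window 0 m ` X = take m ` window 0 n ` X"
    using assms by (simp add: window_def image_image take_map)
  then show ?thesis
    using card_image_le[OF finite_window_image[of 0 n], of "take m"] card_window_image by metis
qed

lemma openin_cylinder: "openin (subshift_topology A X) {y \<in> X. agree a b x y}"
proof -
  have "openin (full_shift A) (\<Pi>\<^sub>E i\<in>UNIV. if a \<le> i \<and> i < b then A \<inter> {x i} else A)"
    unfolding full_shift_def
  proof (rule product_topology_basis)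
    have "finite {a..<b}" by simp
    then show "finite {i. (if a \<le> i \<and> i < b then A \<inter> {x i} else A) \<noteq> topspace (discrete_topology A)}"
      by (rule rev_finite_subset) auto
  qed auto
  then have "openin (subshift_topology A X)
    (X \<inter> (\<Pi>\<^sub>E i\<in>UNIV. if a \<le> i \<and> i < b then A \<inter> {x i} else A))"
    by (rule openin_subtopology_Int2)
  also have "X \<inter> (\<Pi>\<^sub>E i\<in>UNIV. if a \<le> i \<and> i < b then A \<inter> {x i} else A) = {y \<in> X. agree a b x y}"
    using value_in_alphabet by (auto simp: agree_def PiE_def Pi_def split: if_splits)
  finally show ?thesis .
qed

lemma open_contains_cylinder:
  assumes U: "openin (subshift_topology A X) U" and x: "x \<in> U"
  obtains r where "r \<ge> 0" "\<And>y. y \<in> X \<Longrightarrow> agree (- r) (r + 1) x y \<Longrightarrow> y \<in> U"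
proof -
  obtain V where V: "openin (full_shift A) V" "U = V \<inter> X"
    using U by (auto simp: openin_subtopology)
  then obtain W where W: "finite {i. W i \<noteq> A}" "x \<in> Pi\<^sub>E UNIV W" "Pi\<^sub>E UNIV W \<subseteq> V"
    using x unfolding full_shift_def openin_product_topology_alt by fastforce
  define r where "r = Max (insert 0 ((\<lambda>i. \<bar>i\<bar>) ` {i. W i \<noteq> A}))"
  have r: "\<bar>i\<bar> \<le> r" if "W i \<noteq> A" for i
    using W(1) that by (auto simp: r_def)
  have r0: "r \<ge> 0" using W(1) by (simp add: r_def)
  have "y \<in> U" if y: "y \<in> X" "agree (- r) (r + 1) x y" for y
  proof -
    have "y i \<in> W i" for i
    proof (cases "W i = A")
      case True
      then show ?thesis using value_in_alphabet y(1) by simp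
    next
      case False
      then have "x i = y i" using r[OF False] y(2) by (simp add: agree_def abs_le_iff)
      then show ?thesis using W(2) by (metis PiE_mem UNIV_I)
    qed
    then show ?thesis using W(3) V(2) y(1) by (auto simp: PiE_iff)
  qed
  with r0 that show thesis by blast
qed

lemma finite_cylinder_cover:
  obtains Y where "finite Y" "Y \<subseteq> X" "\<And>y. y \<in> X \<Longrightarrow> \<exists>x\<in>Y. agree (- r x) (r x + 1) x y"
proof -
  let ?T = "subshift_topology A X"
  define cyl where "cyl x = {y \<in> X. agree (- r x) (r x + 1) x y}" for x
  have "compact_space (full_shift A)"
    using finite_alphabet
    by (simp add: full_shift_def compact_space_product_topology compact_space_discrete_topology)
  then have "compactin ?T X"
    using subshift closedin_compact_space by (auto simp: subshift_def compactin_subtopology)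
  moreover have "X \<subseteq> \<Union>(cyl ` X)"
    by (auto simp: cyl_def agree_refl)
  moreover have "openin ?T U" if "U \<in> cyl ` X" for U
    using that openin_cylinder by (auto simp: cyl_def)
  ultimately obtain F where F: "finite F" "F \<subseteq> cyl ` X" "X \<subseteq> \<Union>F"
    using compactinD[of ?T X "cyl ` X"] by blast
  then obtain Y where "finite Y" "Y \<subseteq> X" "F = cyl ` Y"
    by (metis finite_subset_image)
  with F(3) that show thesis by (force simp: cyl_def)
qed

section \<open>Automorphisms have finite range\<close>

text \<open>A map that commutes with the shift and satisfies this is a block code of radius \<open>r\<close>.  The radius
  is an integer so that it can be added to positions.\<close>

definition range_le :: "int \<Rightarrow> ((int \<Rightarrow> 'a) \<Rightarrow> (int \<Rightarrow> 'a)) \<Rightarrow> bool" where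
  "range_le r \<phi> \<longleftrightarrow> (\<forall>x\<in>X. \<forall>y\<in>X. agree (- r) (r + 1) x y \<longrightarrow> \<phi> x 0 = \<phi> y 0)"

lemma range_le_mono: "range_le r \<phi> \<Longrightarrow> r \<le> s \<Longrightarrow> range_le s \<phi>"
  unfolding range_le_def by (meson add_right_mono agree_subinterval neg_le_iff_le)

abbreviation AutX (\<open>\<G>\<close>) where "\<G> \<equiv> Aut A X"

lemma carrier_Aut: "carrier \<G> = shift_automorphisms A X"
  by (simp add: Aut_def)

lemma shift_automorphisms_subset_Bij: "shift_automorphisms A X \<subseteq> Bij X"
  using subgroup.subset[OF subgroup_shift_automorphisms[OF subshift]] by (simp add: BijGroup_def)

sublocale Aut: group "\<G>"
  using group_Aut[OF subshift] .

lemma aut_in: "\<phi> \<in> carrier \<G> \<Longrightarrow> x \<in> X \<Longrightarrow> \<phi> x \<in> X"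
  using shift_automorphisms_subset_Bij by (auto simp: carrier_Aut Bij_def bij_betw_def)

lemma aut_mult: "\<phi> \<in> carrier \<G> \<Longrightarrow> \<psi> \<in> carrier \<G> \<Longrightarrow> x \<in> X \<Longrightarrow> (\<phi> \<otimes>\<^bsub>\<G>\<^esub> \<psi>) x = \<phi> (\<psi> x)"
  using shift_automorphisms_subset_Bij
  by (auto simp: carrier_Aut Aut_def BijGroup_def compose_def)

lemma aut_one: "x \<in> X \<Longrightarrow> \<one>\<^bsub>\<G>\<^esub> x = x"
  by (simp add: Aut_def BijGroup_def)

lemma aut_eqI:
  assumes "\<phi> \<in> carrier \<G>" "\<psi> \<in> carrier \<G>" "\<And>x. x \<in> X \<Longrightarrow> \<phi> x = \<psi> x"
  shows "\<phi> = \<psi>"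
  using assms by (intro extensionalityI[of _ X]) (auto simp: carrier_Aut shift_automorphisms_def)

lemma aut_inv_apply: "\<phi> \<in> carrier \<G> \<Longrightarrow> x \<in> X \<Longrightarrow> (inv\<^bsub>\<G>\<^esub> \<phi>) (\<phi> x) = x"
  using aut_mult[of "inv\<^bsub>\<G>\<^esub> \<phi>" \<phi> x] by (simp add: aut_one)

lemma aut_apply_inv: "\<phi> \<in> carrier \<G> \<Longrightarrow> x \<in> X \<Longrightarrow> \<phi> ((inv\<^bsub>\<G>\<^esub> \<phi>) x) = x"
  using aut_mult[of \<phi> "inv\<^bsub>\<G>\<^esub> \<phi>" x] by (simp add: aut_one)

lemma aut_translate:
  assumes \<phi>: "\<phi> \<in> carrier \<G>" and "x \<in> X"
  shows "\<phi> (translate n x) = translate n (\<phi> x)"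
proof -
  have sh: "\<phi> (translate 1 y) = translate 1 (\<phi> y)" if "y \<in> X" for y
    using \<phi> that by (simp add: carrier_Aut shift_automorphisms_def shift_eq_translate)
  show ?thesis
  proof (induction n rule: int_induct[of _ 0])
    case base
    then show ?case by simp
  next
    case (step1 i)
    then show ?case using sh[OF translate_in[OF assms(2)], of i] by (simp add: add.commute)
  next
    case (step2 i)
    have "translate i (\<phi> x) = translate 1 (\<phi> (translate (i - 1) x))"
      using sh[OF translate_in[OF assms(2)], of "i - 1"] step2(2) by simp
    then have "translate (-1) (translate i (\<phi> x)) = \<phi> (translate (i - 1) x)" by simp
    then show ?case by simp
  qed
qed

lemma agree_image:
  assumes \<phi>: "\<phi> \<in> carrier \<G>" "range_le r \<phi>" and xy: "x \<in> X" "y \<in> X"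
    and "agree a b x y" "a \<le> c - r" "d + r \<le> b"
  shows "agree c d (\<phi> x) (\<phi> y)"
  unfolding agree_def
proof (intro allI impI)
  fix i assume i: "c \<le> i \<and> i < d"
  have "agree (- r) (r + 1) (translate i x) (translate i y)"
    unfolding agree_translate by (rule agree_subinterval[OF assms(5)]) (use assms i in auto)
  then have "\<phi> (translate i x) 0 = \<phi> (translate i y) 0"
    using \<phi>(2) translate_in xy unfolding range_le_def by blast
  then show "\<phi> x i = \<phi> y i"
    using \<phi>(1) xy by (simp add: aut_translate) (simp add: translate_def)
qed

lemma range_le_one: "r \<ge> 0 \<Longrightarrow> range_le r \<one>\<^bsub>\<G>\<^esub>"
  by (auto simp: range_le_def aut_one agree_def)

lemma range_le_mult:
  assumes "\<phi> \<in> carrier \<G>" "\<psi> \<in> carrier \<G>" "range_le r \<phi>" "range_le s \<psi>"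
  shows "range_le (r + s) (\<phi> \<otimes>\<^bsub>\<G>\<^esub> \<psi>)"
  unfolding range_le_def
proof (intro ballI impI)
  fix x y assume xy: "x \<in> X" "y \<in> X" "agree (- (r + s)) (r + s + 1) x y"
  have "agree (- r) (r + 1) (\<psi> x) (\<psi> y)"
    by (rule agree_image[OF assms(2,4) xy]) auto
  then show "(\<phi> \<otimes>\<^bsub>\<G>\<^esub> \<psi>) x 0 = (\<phi> \<otimes>\<^bsub>\<G>\<^esub> \<psi>) y 0"
    using assms xy aut_in unfolding range_le_def by (simp add: aut_mult)
qed

text \<open>The Curtis--Hedlund--Lyndon theorem: by continuity the symbol of \<open>\<phi> x\<close> at the origin is
  determined by a window of \<open>x\<close>, and compactness makes the size of the window uniform.\<close>

lemma exists_range: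
  assumes \<phi>: "\<phi> \<in> carrier \<G>"
  obtains r where "r \<ge> 0" "range_le r \<phi>"
proof -
  let ?T = "subshift_topology A X"
  have cont: "continuous_map ?T ?T \<phi>"
    using \<phi> by (simp add: carrier_Aut shift_automorphisms_def homeomorphic_imp_continuous_map)
  have "\<exists>r\<ge>0. \<forall>y\<in>X. agree (- r) (r + 1) x y \<longrightarrow> \<phi> y 0 = \<phi> x 0" if x: "x \<in> X" for x
  proof -
    define U where "U = {y \<in> topspace ?T. \<phi> y \<in> {z \<in> X. agree 0 1 (\<phi> x) z}}"
    have "openin ?T U"
      unfolding U_def by (rule openin_continuous_map_preimage[OF cont openin_cylinder])
    moreover have "x \<in> U"
      using x aut_in[OF \<phi>] unfolding U_def topspace_subshift by (simp add: agree_refl)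
    ultimately obtain r where "r \<ge> 0" "\<And>y. y \<in> X \<Longrightarrow> agree (- r) (r + 1) x y \<Longrightarrow> y \<in> U"
      using open_contains_cylinder by blast
    then show ?thesis by (auto simp: U_def agree_def intro!: exI[of _ r])
  qed
  then obtain r where r: "\<And>x. x \<in> X \<Longrightarrow> r x \<ge> 0"
    "\<And>x y. x \<in> X \<Longrightarrow> y \<in> X \<Longrightarrow> agree (- r x) (r x + 1) x y \<Longrightarrow> \<phi> y 0 = \<phi> x 0"
    by metis
  obtain Y where Y: "finite Y" "Y \<subseteq> X" "\<And>y. y \<in> X \<Longrightarrow> \<exists>x\<in>Y. agree (- r x) (r x + 1) x y"
    using finite_cylinder_cover[of r] by blast
  define R where "R = Max (insert 0 (r ` Y))"
  have R: "R \<ge> 0" "\<And>x. x \<in> Y \<Longrightarrow> r x \<le> R" using Y(1) by (auto simp: R_def)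
  have "range_le R \<phi>"
    unfolding range_le_def
  proof (intro ballI impI)
    fix y z assume yz: "y \<in> X" "z \<in> X" "agree (- R) (R + 1) y z"
    obtain x where x: "x \<in> Y" "agree (- r x) (r x + 1) x y" using Y(3)[OF yz(1)] by blast
    have "agree (- r x) (r x + 1) y z"
      using yz(3) R(2)[OF x(1)] by (auto elim: agree_subinterval)
    then have "agree (- r x) (r x + 1) x z" using x(2) agree_trans by blast
    then show "\<phi> y 0 = \<phi> z 0"
      using r(2)[of x y] r(2)[of x z] x Y(2) yz by auto
  qed
  with R(1) that show thesis by blast
qed

lemma finite_automorphisms_of_range:
  assumes "r \<ge> 0" shows "finite {\<phi> \<in> carrier \<G>. range_le r \<phi>}"
proof -
  define n where "n = nat (2 * r + 1)"
  have n: "- r + int n = r + 1" using assms by (simp add: n_def)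
  define code where "code \<phi> = (\<lambda>x. (window (- r) n x, \<phi> x 0)) ` X" for \<phi> :: "(int \<Rightarrow> 'a) \<Rightarrow> int \<Rightarrow> 'a"
  have "code ` {\<phi> \<in> carrier \<G>. range_le r \<phi>} \<subseteq> Pow (window (- r) n ` X \<times> A)"
    using aut_in value_in_alphabet by (auto simp: code_def)
  moreover have "finite (Pow (window (- r) n ` X \<times> A))"
    using finite_window_image finite_alphabet by simp
  ultimately have "finite (code ` {\<phi> \<in> carrier \<G>. range_le r \<phi>})"
    by (rule finite_subset)
  moreover have "inj_on code {\<phi> \<in> carrier \<G>. range_le r \<phi>}"
  proof (rule inj_onI)
    fix \<phi> \<psi> assume \<phi>: "\<phi> \<in> {\<phi> \<in> carrier \<G>. range_le r \<phi>}" and \<psi>: "\<psi> \<in> {\<phi> \<in> carrier \<G>. range_le r \<phi>}"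
      and eq: "code \<phi> = code \<psi>"
    have zero: "\<phi> x 0 = \<psi> x 0" if x: "x \<in> X" for x
    proof -
      have "(window (- r) n x, \<phi> x 0) \<in> code \<psi>"
        unfolding eq[symmetric] using x by (auto simp: code_def)
      then obtain y where y: "y \<in> X" "window (- r) n x = window (- r) n y" "\<phi> x 0 = \<psi> y 0"
        by (auto simp: code_def)
      then have "agree (- r) (r + 1) x y" using n by (simp add: window_eq_iff_agree)
      then show ?thesis using y x \<psi> by (auto simp: range_le_def)
    qed
    show "\<phi> = \<psi>"
    proof (rule aut_eqI)
      fix x assume x: "x \<in> X"
      show "\<phi> x = \<psi> x"
      proof
        fix i
        show "\<phi> x i = \<psi> x i"
          using zero[OF translate_in[OF x, of i]] x \<phi> \<psi>
          by (simp add: aut_translate) (simp add: translate_def)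
      qed
    qed (use \<phi> \<psi> in auto)
  qed
  ultimately show ?thesis by (rule finite_imageD)
qed

lemma countable_Aut: "countable (carrier \<G>)"
proof -
  have "carrier \<G> \<subseteq> (\<Union>r\<in>{0..}. {\<phi> \<in> carrier \<G>. range_le r \<phi>})"
  proof
    fix \<phi> assume \<phi>: "\<phi> \<in> carrier \<G>"
    then obtain r where "r \<ge> 0" "range_le r \<phi>" by (rule exists_range)
    with \<phi> show "\<phi> \<in> (\<Union>r\<in>{0..}. {\<phi> \<in> carrier \<G>. range_le r \<phi>})" by auto
  qed
  moreover have "countable (\<Union>r\<in>{0..}. {\<phi> \<in> carrier \<G>. range_le r \<phi>})"
  proof (rule countable_UN)
    show "countable {\<phi> \<in> carrier \<G>. range_le r \<phi>}" if "r \<in> {0..}" for r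
      using finite_automorphisms_of_range[of r] that countable_finite by simp
  qed simp
  ultimately show ?thesis by (rule countable_subset)
qed

section \<open>Words with a forced extension\<close>

text \<open>If every word of length \<open>n\<close> had two extensions by \<open>k\<close> symbols on both sides, these would be
  \<open>2 * complexity X n\<close> different words of length \<open>n + 2 * k\<close>.\<close>

lemma exists_forced_extension:
  assumes "complexity X (n + 2 * k) < 2 * complexity X n"
  shows "\<exists>x\<in>X. \<forall>y\<in>X. agree 0 (int n) x y \<longrightarrow> agree (- int k) (int n + int k) x y"
proof (rule ccontr)
  assume "\<not> ?thesis"
  then have "\<forall>x\<in>X. \<exists>y\<in>X. agree 0 (int n) x y \<and> \<not> agree (- int k) (int n + int k) x y" by blast
  then obtain g where g: "\<And>x. x \<in> X \<Longrightarrow> g x \<in> X" "\<And>x. x \<in> X \<Longrightarrow> agree 0 (int n) x (g x)"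
    "\<And>x. x \<in> X \<Longrightarrow> \<not> agree (- int k) (int n + int k) x (g x)" by metis
  define W where "W = window 0 n ` X"
  define V where "V = window (- int k) (n + 2 * k) ` X"
  define p where "p = inv_into X (window 0 n)"
  have p: "p w \<in> X" "window 0 n (p w) = w" if "w \<in> W" for w
    using that unfolding W_def p_def by (simp_all add: inv_into_into f_inv_into_f)
  define e1 where "e1 w = window (- int k) (n + 2 * k) (p w)" for w
  define e2 where "e2 w = window (- int k) (n + 2 * k) (g (p w))" for w
  have mid: "window 0 n x = window 0 n y"
    if "window (- int k) (n + 2 * k) x = window (- int k) (n + 2 * k) y" for x y :: "int \<Rightarrow> 'a"
    using that by (auto simp: window_eq_iff_agree elim: agree_subinterval)
  have gp: "window 0 n (g (p w)) = w" if "w \<in> W" for w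
    using g(2)[OF p(1)[OF that]] p(2)[OF that] window_eq_iff_agree[of 0 n "p w" "g (p w)"] by simp
  have "inj_on e1 W" "inj_on e2 W"
    unfolding inj_on_def e1_def e2_def using mid p(2) gp by metis+
  then have card: "card (e1 ` W) = complexity X n" "card (e2 ` W) = complexity X n"
    by (simp_all add: card_image W_def card_window_image)
  have disj: "e1 ` W \<inter> e2 ` W = {}"
  proof -
    have False if w: "w \<in> W" "w' \<in> W" "e1 w = e2 w'" for w w'
    proof -
      have "w = w'" using mid[OF w(3)[unfolded e1_def e2_def]] p(2) gp w by metis
      then have "agree (- int k) (- int k + int (n + 2 * k)) (p w) (g (p w))"
        using w(3) by (simp only: e1_def e2_def window_eq_iff_agree)
      then show False using g(3)[OF p(1)[OF w(1)]] by (simp add: algebra_simps)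
    qed
    then show ?thesis by blast
  qed
  have fin: "finite W" unfolding W_def by (rule finite_window_image)
  have "2 * complexity X n = card (e1 ` W \<union> e2 ` W)"
    using fin disj card by (simp add: card_Un_disjoint)
  also have "\<dots> \<le> card V"
    using p(1) g(1) by (intro card_mono) (auto simp: V_def e1_def e2_def finite_window_image)
  also have "\<dots> = complexity X (n + 2 * k)" by (simp add: V_def card_window_image)
  finally show False using assms by simp
qed

lemma exists_step_without_doubling:
  assumes "X \<noteq> {}" "complexity X (m * L) < 2 ^ L"
  shows "\<exists>j<L. complexity X (m * j + m) < 2 * complexity X (m * j)"
proof (rule ccontr)
  assume "\<not> ?thesis"
  then have step: "complexity X (m * j + m) \<ge> 2 * complexity X (m * j)" if "j < L" for j
    using that by force
  have "complexity X (m * j) \<ge> 2 ^ j" if "j \<le> L" for j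
    using that
  proof (induction j)
    case 0
    have "window 0 0 ` X \<noteq> {}" using assms(1) by blast
    then have "card (window 0 0 ` X) > 0" using finite_window_image card_gt_0_iff by blast
    then show ?case by (simp add: card_window_image)
  next
    case (Suc j)
    then show ?case using step[of j] by (simp add: add.commute)
  qed
  from this[of L] assms(2) show False by simp
qed

section \<open>Automorphisms preserving the occurrences of a word\<close>

text \<open>By minimality every point has a translate carrying the word of \<open>x0\<close>, and this is decided by a
  finite window; compactness makes the translation distance uniform.\<close>

lemma bounded_returns:
  assumes min: "minimal_subshift A X" and x0: "x0 \<in> X"
  obtains M where "M \<ge> 0" "\<And>y. y \<in> X \<Longrightarrow> \<exists>p. \<bar>p\<bar> \<le> M \<and> agree 0 n x0 (translate p y)"
proof -
  have "\<exists>p. agree 0 n x0 (translate p y)" if y: "y \<in> X" for y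
  proof -
    have "x0 \<in> subshift_topology A X closure_of shift_orbit y"
      using min x0 y unfolding minimal_subshift_def by simp
    then have "\<And>T. x0 \<in> T \<and> openin (subshift_topology A X) T \<Longrightarrow> \<exists>z. z \<in> shift_orbit y \<and> z \<in> T"
      by (simp only: in_closure_of)
    from this[of "{z \<in> X. agree 0 n x0 z}"] obtain z where "z \<in> shift_orbit y" "agree 0 n x0 z"
      using openin_cylinder[of 0 n x0] x0 agree_refl[of 0 n x0] by auto
    then show ?thesis by (auto simp: shift_orbit_def translate_def)
  qed
  then obtain p where p: "\<And>y. y \<in> X \<Longrightarrow> agree 0 n x0 (translate (p y) y)" by metis
  define r where "r y = \<bar>p y\<bar> + \<bar>n\<bar>" for y
  obtain Y where Y: "finite Y" "Y \<subseteq> X" "\<And>y. y \<in> X \<Longrightarrow> \<exists>x\<in>Y. agree (- r x) (r x + 1) x y"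
    using finite_cylinder_cover[of r] by blast
  define M where "M = Max (insert 0 ((\<lambda>x. \<bar>p x\<bar>) ` Y))"
  have M: "M \<ge> 0" "\<And>x. x \<in> Y \<Longrightarrow> \<bar>p x\<bar> \<le> M" using Y(1) by (auto simp: M_def)
  have "\<exists>q. \<bar>q\<bar> \<le> M \<and> agree 0 n x0 (translate q y)" if y: "y \<in> X" for y
  proof -
    obtain x where x: "x \<in> Y" "agree (- r x) (r x + 1) x y" using Y(3)[OF y] by blast
    have "agree 0 n (translate (p x) x) (translate (p x) y)"
      unfolding agree_translate by (rule agree_subinterval[OF x(2)]) (auto simp: r_def)
    then have "agree 0 n x0 (translate (p x) y)" using p x(1) Y(2) agree_trans by blast
    then show ?thesis using M(2)[OF x(1)] by blast
  qed
  with M(1) that show thesis by blast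
qed

text \<open>The word in question is that of \<open>x0\<close> on \<open>[0, n)\<close>.  The second condition says that the image of a
  configuration between two occurrences of the word depends only on the configuration between them;
  it replaces the permutation of return words.  Both conditions are equivalences, which makes the
  set closed under inverses.\<close>

definition occurrence_stabilizer ::
    "(int \<Rightarrow> 'a) \<Rightarrow> int \<Rightarrow> ((int \<Rightarrow> 'a) \<Rightarrow> (int \<Rightarrow> 'a)) set" where
  "occurrence_stabilizer x0 n = {\<phi> \<in> carrier \<G>.
     (\<forall>x\<in>X. agree 0 n x0 (\<phi> x) \<longleftrightarrow> agree 0 n x0 x) \<and>
     (\<forall>x\<in>X. \<forall>y\<in>X. \<forall>l>0.
        agree 0 n x0 x \<and> agree 0 n x0 (translate l x) \<and>
        agree 0 n x0 y \<and> agree 0 n x0 (translate l y) \<longrightarrow>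
        (agree 0 l (\<phi> x) (\<phi> y) \<longleftrightarrow> agree 0 l x y))}"

lemma occurrence_stabilizerD:
  assumes "\<phi> \<in> occurrence_stabilizer x0 n"
  shows "\<phi> \<in> carrier \<G>"
    and "x \<in> X \<Longrightarrow> agree 0 n x0 (\<phi> x) \<longleftrightarrow> agree 0 n x0 x"
    and "x \<in> X \<Longrightarrow> agree 0 n x0 (translate l (\<phi> x)) \<longleftrightarrow> agree 0 n x0 (translate l x)"
    and "x \<in> X \<Longrightarrow> y \<in> X \<Longrightarrow> l > 0 \<Longrightarrow> agree 0 n x0 x \<Longrightarrow> agree 0 n x0 (translate l x) \<Longrightarrow>
      agree 0 n x0 y \<Longrightarrow> agree 0 n x0 (translate l y) \<Longrightarrow>
      agree 0 l (\<phi> x) (\<phi> y) \<longleftrightarrow> agree 0 l x y"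
proof -
  show c: "\<phi> \<in> carrier \<G>" using assms by (simp add: occurrence_stabilizer_def)
  show o: "agree 0 n x0 (\<phi> x) \<longleftrightarrow> agree 0 n x0 x" if "x \<in> X" for x
    using assms that by (simp add: occurrence_stabilizer_def)
  show "agree 0 n x0 (translate l (\<phi> x)) \<longleftrightarrow> agree 0 n x0 (translate l x)" if "x \<in> X"
    using o[OF translate_in[OF that, of l]] aut_translate[OF c that] by simp
  show "agree 0 l (\<phi> x) (\<phi> y) \<longleftrightarrow> agree 0 l x y"
    if "x \<in> X" "y \<in> X" "l > 0" "agree 0 n x0 x" "agree 0 n x0 (translate l x)"
      "agree 0 n x0 y" "agree 0 n x0 (translate l y)"
    using assms that by (simp add: occurrence_stabilizer_def)
qed

lemma subgroup_occurrence_stabilizer: "subgroup (occurrence_stabilizer x0 n) \<G>"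
proof (rule Aut.subgroupI)
  show "occurrence_stabilizer x0 n \<subseteq> carrier \<G>"
    by (auto simp: occurrence_stabilizer_def)
  have "\<one>\<^bsub>\<G>\<^esub> \<in> occurrence_stabilizer x0 n"
    by (simp add: occurrence_stabilizer_def aut_one)
  then show "occurrence_stabilizer x0 n \<noteq> {}" by blast
next
  fix \<phi> assume \<phi>: "\<phi> \<in> occurrence_stabilizer x0 n"
  note D = occurrence_stabilizerD[OF \<phi>]
  let ?\<psi> = "inv\<^bsub>\<G>\<^esub> \<phi>"
  have \<psi>: "?\<psi> \<in> carrier \<G>" "\<And>x. x \<in> X \<Longrightarrow> ?\<psi> x \<in> X" "\<And>x. x \<in> X \<Longrightarrow> \<phi> (?\<psi> x) = x"
    using D(1) aut_in aut_apply_inv by simp_all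
  have occ: "agree 0 n x0 (?\<psi> x) \<longleftrightarrow> agree 0 n x0 x"
    "agree 0 n x0 (translate l (?\<psi> x)) \<longleftrightarrow> agree 0 n x0 (translate l x)" if "x \<in> X" for x l
    using D(2,3)[OF \<psi>(2)[OF that]] \<psi>(3)[OF that] by simp_all
  have "agree 0 l (?\<psi> x) (?\<psi> y) \<longleftrightarrow> agree 0 l x y"
    if "x \<in> X" "y \<in> X" "l > 0" "agree 0 n x0 x" "agree 0 n x0 (translate l x)"
      "agree 0 n x0 y" "agree 0 n x0 (translate l y)" for x y l
    using D(4)[OF \<psi>(2)[OF that(1)] \<psi>(2)[OF that(2)] that(3)] that occ \<psi>(3) by simp
  then show "?\<psi> \<in> occurrence_stabilizer x0 n"
    unfolding occurrence_stabilizer_def using \<psi>(1) occ by blast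
next
  fix \<phi> \<psi> assume \<phi>: "\<phi> \<in> occurrence_stabilizer x0 n" and \<psi>: "\<psi> \<in> occurrence_stabilizer x0 n"
  note D = occurrence_stabilizerD[OF \<phi>] and E = occurrence_stabilizerD[OF \<psi>]
  note m = aut_mult[OF D(1) E(1)] and i = aut_in[OF E(1)]
  have "agree 0 l (\<phi> (\<psi> x)) (\<phi> (\<psi> y)) \<longleftrightarrow> agree 0 l x y"
    if "x \<in> X" "y \<in> X" "l > 0" "agree 0 n x0 x" "agree 0 n x0 (translate l x)"
      "agree 0 n x0 y" "agree 0 n x0 (translate l y)" for x y l
    using D(4)[OF i[OF that(1)] i[OF that(2)] that(3)] E(2,3,4) that by simp
  then show "\<phi> \<otimes>\<^bsub>\<G>\<^esub> \<psi> \<in> occurrence_stabilizer x0 n"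
    unfolding occurrence_stabilizer_def using D(1,2) E(1,2) i by (simp add: m)
qed

text \<open>Every position lies between two occurrences of the word at bounded distance, and an
  automorphism in the stabilizer is determined there by the word in between.  Hence a common
  range bounds all these automorphisms.\<close>

lemma finite_occurrence_stabilizer:
  assumes min: "minimal_subshift A X" and x0: "x0 \<in> X" and n: "n \<ge> 0"
  shows "finite (occurrence_stabilizer x0 n)"
proof -
  obtain M where M: "M \<ge> 0" "\<And>y. y \<in> X \<Longrightarrow> \<exists>p. \<bar>p\<bar> \<le> M \<and> agree 0 n x0 (translate p y)"
    using bounded_returns[OF min x0] by blast
  define r where "r = 2 * M + 1 + n"
  have "range_le r \<phi>" if \<phi>: "\<phi> \<in> occurrence_stabilizer x0 n" for \<phi>
    unfolding range_le_def
  proof (intro ballI impI)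
    note D = occurrence_stabilizerD[OF \<phi>]
    fix x y assume xy: "x \<in> X" "y \<in> X" "agree (- r) (r + 1) x y"
    \<comment> \<open>Shifting \<open>x\<close> by \<open>- M\<close> and by \<open>M + 1\<close> first separates the occurrences found on both sides
      of the origin.\<close>
    obtain p' where p': "\<bar>p'\<bar> \<le> M" "agree 0 n x0 (translate p' (translate (- M) x))"
      using M(2)[OF translate_in[OF xy(1)]] by blast
    obtain q' where q': "\<bar>q'\<bar> \<le> M" "agree 0 n x0 (translate q' (translate (M + 1) x))"
      using M(2)[OF translate_in[OF xy(1)]] by blast
    define p q where "p = p' - M" and "q = q' + (M + 1)"
    have pq: "- (2 * M) \<le> p" "p \<le> 0" "0 < q" "q \<le> 2 * M + 1"
      using p'(1) q'(1) by (auto simp: p_def q_def)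
    have px: "agree 0 n x0 (translate p x)" and qx: "agree 0 n x0 (translate q x)"
      using p'(2) q'(2) by (simp_all add: p_def q_def)
    have "agree 0 n (translate p x) (translate p y)" "agree 0 n (translate q x) (translate q y)"
      unfolding agree_translate
      by (rule agree_subinterval[OF xy(3)]; use pq n M(1) in \<open>simp add: r_def\<close>)+
    then have py: "agree 0 n x0 (translate p y)" and qy: "agree 0 n x0 (translate q y)"
      using px qx agree_trans by blast+
    have "agree 0 (q - p) (translate p x) (translate p y)"
      unfolding agree_translate
      by (rule agree_subinterval[OF xy(3)]) (use pq n M(1) in \<open>simp_all add: r_def\<close>)
    moreover have "q - p > 0" using pq by simp
    ultimately have "agree 0 (q - p) (\<phi> (translate p x)) (\<phi> (translate p y))"
      using D(4)[OF translate_in[OF xy(1)] translate_in[OF xy(2)], of "q - p" p p] px py qx qy by simp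
    then have "agree p q (\<phi> x) (\<phi> y)"
      using aut_translate[OF D(1)] xy by (simp add: agree_translate)
    then show "\<phi> x 0 = \<phi> y 0" using pq by (simp add: agree_def)
  qed
  then have "occurrence_stabilizer x0 n \<subseteq> {\<phi> \<in> carrier \<G>. range_le r \<phi>}"
    using occurrence_stabilizerD(1) by blast
  moreover have "r \<ge> 0" using M n by (simp add: r_def)
  ultimately show ?thesis using finite_automorphisms_of_range finite_subset by blast
qed

text \<open>When the word forces its surroundings up to the range of \<open>\<phi>\<close>, the part of a configuration
  between two occurrences of the word determines the image of the configuration there.  The
  condition on the words between occurrences is then automatic.\<close>

lemma in_occurrence_stabilizer:
  assumes k: "0 \<le> r" "r \<le> k" and n: "n \<ge> 0"
    and forced: "\<And>y. y \<in> X \<Longrightarrow> agree 0 n x0 y \<Longrightarrow> agree (- k) (n + k) x0 y"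
    and \<phi>: "\<phi> \<in> carrier \<G>" "range_le r \<phi>" "range_le r (inv\<^bsub>\<G>\<^esub> \<phi>)"
    and occ: "\<And>x. x \<in> X \<Longrightarrow> agree 0 n x0 (\<phi> x) \<longleftrightarrow> agree 0 n x0 x"
  shows "\<phi> \<in> occurrence_stabilizer x0 n"
proof -
  have im: "agree 0 l (\<psi> x) (\<psi> y)"
    if "x \<in> X" "y \<in> X" "l > 0" "agree 0 n x0 x" "agree 0 n x0 (translate l x)"
      "agree 0 n x0 y" "agree 0 n x0 (translate l y)" "agree 0 l x y"
      "\<psi> \<in> carrier \<G>" "range_le r \<psi>" for x y l \<psi>
  proof -
    have surroundings: "agree (- k) (n + k) u w"
      if "u \<in> X" "w \<in> X" "agree 0 n x0 u" "agree 0 n x0 w" for u w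
      using agree_trans[OF agree_sym[OF forced[OF that(1,3)]] forced[OF that(2,4)]] .
    have "agree (- k) (n + k) x y"
      using surroundings that by simp
    moreover have "agree (- k) (n + k) (translate l x) (translate l y)"
      using surroundings translate_in that by simp
    then have "agree (l - k) (l + n + k) x y" by (simp add: agree_translate algebra_simps)
    ultimately have "agree (- k) (l + n + k) x y"
      using agree_join[OF agree_join[of "- k" "n + k" x y 0 l] , of "l - k" "l + n + k"]
        that(8) k n by simp
    then show ?thesis
      by (rule agree_image[OF that(9,10,1,2)]) (use k n in auto)
  qed
  have "agree 0 l (\<phi> x) (\<phi> y) \<longleftrightarrow> agree 0 l x y"
    if xy: "x \<in> X" "y \<in> X" "l > 0" "agree 0 n x0 x" "agree 0 n x0 (translate l x)"
      "agree 0 n x0 y" "agree 0 n x0 (translate l y)" for x y l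
  proof
    assume "agree 0 l x y"
    then show "agree 0 l (\<phi> x) (\<phi> y)" using im[OF xy] \<phi> by blast
  next
    assume *: "agree 0 l (\<phi> x) (\<phi> y)"
    have "agree 0 l ((inv\<^bsub>\<G>\<^esub> \<phi>) (\<phi> x)) ((inv\<^bsub>\<G>\<^esub> \<phi>) (\<phi> y))"
    proof (rule im[OF _ _ xy(3) _ _ _ _ *])
      show "\<phi> x \<in> X" "\<phi> y \<in> X" using xy(1,2) aut_in[OF \<phi>(1)] by blast+
      show "agree 0 n x0 (\<phi> x)" "agree 0 n x0 (\<phi> y)" using xy occ by blast+
      show "agree 0 n x0 (translate l (\<phi> x))" "agree 0 n x0 (translate l (\<phi> y))"
        using xy occ[OF translate_in] by (simp_all only: aut_translate[OF \<phi>(1), symmetric])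
      show "inv\<^bsub>\<G>\<^esub> \<phi> \<in> carrier \<G>" "range_le r (inv\<^bsub>\<G>\<^esub> \<phi>)"
        using \<phi>(1,3) by simp_all
    qed
    then show "agree 0 l x y" using \<phi>(1) xy aut_inv_apply by simp
  qed
  then show ?thesis
    unfolding occurrence_stabilizer_def using \<phi>(1) occ by blast
qed

lemma card_image_le_if_factors:
  assumes "finite (v ` B)" "\<And>a b. a \<in> B \<Longrightarrow> b \<in> B \<Longrightarrow> v a = v b \<Longrightarrow> f a = f b"
  shows "card (f ` B) \<le> card (v ` B)"
proof -
  have "f b = f (inv_into B v (v b))" if "b \<in> B" for b
    using that by (intro assms(2)) (simp_all add: inv_into_into f_inv_into_f)
  then have "f ` B = (\<lambda>w. f (inv_into B v w)) ` v ` B" by (auto simp: image_image)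
  then show ?thesis using card_image_le[OF assms(1)] by metis
qed

text \<open>The coset of \<open>\<phi>\<close> is determined by \<open>\<phi> x0\<close> on \<open>[- r, n + r)\<close>.  If \<open>\<psi> x0\<close> is the same there and
  \<open>x\<close> carries the word of \<open>x0\<close>, then \<open>\<psi> x\<close> agrees with \<open>\<psi> x0\<close>, hence with \<open>\<phi> x0\<close>, on this
  interval, because the word is forced up to distance \<open>2 * r\<close>; so \<open>\<phi>\<inverse> (\<psi> x)\<close> carries the word
  again.\<close>

lemma card_cosets_le_complexity:
  assumes x0: "x0 \<in> X" and rk: "2 * r \<le> k"
    and forced: "\<And>y. y \<in> X \<Longrightarrow> agree 0 (int n) x0 y \<Longrightarrow> agree (- int k) (int n + int k) x0 y"
    and B: "\<And>\<phi>. \<phi> \<in> B \<Longrightarrow> \<phi> \<in> carrier \<G> \<and> range_le (int r) \<phi> \<and> range_le (int r) (inv\<^bsub>\<G>\<^esub> \<phi>)"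
  shows "card ((\<lambda>\<phi>. \<phi> <#\<^bsub>\<G>\<^esub> occurrence_stabilizer x0 (int n)) ` B) \<le> complexity X (n + 2 * r)"
proof -
  define v where "v \<phi> = window (- int r) (n + 2 * r) (\<phi> x0)" for \<phi> :: "(int \<Rightarrow> 'a) \<Rightarrow> int \<Rightarrow> 'a"
  have v_eq: "v \<phi> = v \<psi> \<longleftrightarrow> agree (- int r) (int n + int r) (\<phi> x0) (\<psi> x0)" for \<phi> \<psi>
    by (simp add: v_def window_eq_iff_agree algebra_simps)
  have occ: "agree 0 (int n) x0 ((inv\<^bsub>\<G>\<^esub> \<phi> \<otimes>\<^bsub>\<G>\<^esub> \<psi>) x)"
    if "\<phi> \<in> B" "\<psi> \<in> B" "v \<phi> = v \<psi>" "x \<in> X" "agree 0 (int n) x0 x" for \<phi> \<psi> x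
  proof -
    note \<phi> = B[OF that(1)] and \<psi> = B[OF that(2)]
    have in_X: "\<psi> x0 \<in> X" "\<psi> x \<in> X" "\<phi> x0 \<in> X" using \<phi> \<psi> x0 that(4) aut_in by blast+
    have "agree (- int r) (int n + int r) (\<psi> x0) (\<psi> x)"
      by (rule agree_image[OF _ _ x0 that(4) forced[OF that(4,5)], of _ "int r"])
         (use \<psi> rk in simp_all)
    then have "agree (- int r) (int n + int r) (\<phi> x0) (\<psi> x)"
      using that(3) v_eq agree_trans by blast
    from agree_image[OF _ _ in_X(3,2) this, of "inv\<^bsub>\<G>\<^esub> \<phi>" "int r" 0 "int n"]
    have "agree 0 (int n) ((inv\<^bsub>\<G>\<^esub> \<phi>) (\<phi> x0)) ((inv\<^bsub>\<G>\<^esub> \<phi>) (\<psi> x))"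
      using \<phi> by simp
    then show ?thesis using \<phi> \<psi> x0 that(4) by (simp add: aut_inv_apply aut_mult)
  qed
  have stab: "inv\<^bsub>\<G>\<^esub> \<phi> \<otimes>\<^bsub>\<G>\<^esub> \<psi> \<in> occurrence_stabilizer x0 (int n)"
    if that: "\<phi> \<in> B" "\<psi> \<in> B" "v \<phi> = v \<psi>" for \<phi> \<psi>
  proof (rule in_occurrence_stabilizer[OF _ _ _ forced])
    note \<phi> = B[OF that(1)] and \<psi> = B[OF that(2)]
    let ?\<theta> = "inv\<^bsub>\<G>\<^esub> \<phi> \<otimes>\<^bsub>\<G>\<^esub> \<psi>"
    have inv: "inv\<^bsub>\<G>\<^esub> ?\<theta> = inv\<^bsub>\<G>\<^esub> \<psi> \<otimes>\<^bsub>\<G>\<^esub> \<phi>"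
      using \<phi> \<psi> by (simp add: Aut.inv_mult_group)
    show \<theta>: "?\<theta> \<in> carrier \<G>" using \<phi> \<psi> by simp
    show "range_le (int (2 * r)) ?\<theta>" "range_le (int (2 * r)) (inv\<^bsub>\<G>\<^esub> ?\<theta>)"
      unfolding inv using \<phi> \<psi> range_le_mult[of _ _ "int r" "int r"] by simp_all
    fix x assume x: "x \<in> X"
    show "agree 0 (int n) x0 (?\<theta> x) \<longleftrightarrow> agree 0 (int n) x0 x"
    proof
      assume "agree 0 (int n) x0 (?\<theta> x)"
      then have "agree 0 (int n) x0 ((inv\<^bsub>\<G>\<^esub> ?\<theta>) (?\<theta> x))"
        unfolding inv using occ[OF that(2,1)] that(3) aut_in[OF \<theta> x] by simp
      then show "agree 0 (int n) x0 x" using aut_inv_apply[OF \<theta> x] by simp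
    qed (use occ that x in blast)
  qed (use rk in auto)
  have "card ((\<lambda>\<phi>. \<phi> <#\<^bsub>\<G>\<^esub> occurrence_stabilizer x0 (int n)) ` B) \<le> card (v ` B)"
  proof (rule card_image_le_if_factors)
    have "v ` B \<subseteq> window (- int r) (n + 2 * r) ` X"
      using B x0 aut_in by (auto simp: v_def)
    then show "finite (v ` B)" using finite_window_image finite_subset by blast
    show "\<phi> <#\<^bsub>\<G>\<^esub> occurrence_stabilizer x0 (int n) = \<psi> <#\<^bsub>\<G>\<^esub> occurrence_stabilizer x0 (int n)"
      if "\<phi> \<in> B" "\<psi> \<in> B" "v \<phi> = v \<psi>" for \<phi> \<psi>
      using stab[OF that] B[OF that(1)] B[OF that(2)]
        Aut.l_coset_eq_iff[OF subgroup_occurrence_stabilizer, of \<phi> \<psi>] by simp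
  qed
  also have "\<dots> \<le> card (window (- int r) (n + 2 * r) ` X)"
    using B x0 aut_in by (intro card_mono finite_window_image) (auto simp: v_def)
  finally show ?thesis by (simp add: card_window_image)
qed

text \<open>The bound \<open>2 ^ (2 * k)\<close> at length \<open>4 * k\<^sup>2\<close> is that of \<open>2 * k\<close> doublings in steps of width \<open>2 * k\<close>.
  Below it, the step from some length \<open>n\<close> does not double the complexity, and a word of length \<open>n\<close> is
  forced up to distance \<open>k\<close>.\<close>

lemma exists_finite_subgroup_with_few_cosets:
  assumes min: "minimal_subshift A X" and rk: "2 * r \<le> k"
    and small: "complexity X (4 * k\<^sup>2) < 2 ^ (2 * k)"
  shows "\<exists>H. subgroup H \<G> \<and> finite H \<and>
    (\<forall>B. (\<forall>\<phi>\<in>B. \<phi> \<in> carrier \<G> \<and> range_le (int r) \<phi> \<and> range_le (int r) (inv\<^bsub>\<G>\<^esub> \<phi>)) \<longrightarrow>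
       card ((\<lambda>\<phi>. \<phi> <#\<^bsub>\<G>\<^esub> H) ` B) \<le> complexity X (4 * k\<^sup>2))"
proof -
  have sq: "4 * k\<^sup>2 = 2 * k * (2 * k)" by (simp add: power2_eq_square)
  have "X \<noteq> {}" using min by (simp add: minimal_subshift_def)
  then obtain j where j: "j < 2 * k" "complexity X (2 * k * j + 2 * k) < 2 * complexity X (2 * k * j)"
    using exists_step_without_doubling[of "2 * k" "2 * k"] small unfolding sq by blast
  define n where "n = 2 * k * j"
  have "2 * k * (j + 1) \<le> 2 * k * (2 * k)" using j(1) by (intro mult_le_mono2) simp
  then have n: "n + 2 * r \<le> 4 * k\<^sup>2" using rk unfolding sq n_def by simp
  obtain x0 where x0: "x0 \<in> X"
    and forced: "\<And>y. y \<in> X \<Longrightarrow> agree 0 (int n) x0 y \<Longrightarrow> agree (- int k) (int n + int k) x0 y"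
    using exists_forced_extension[of n k] j(2) unfolding n_def by blast
  have "card ((\<lambda>\<phi>. \<phi> <#\<^bsub>\<G>\<^esub> occurrence_stabilizer x0 (int n)) ` B) \<le> complexity X (4 * k\<^sup>2)"
    if "\<forall>\<phi>\<in>B. \<phi> \<in> carrier \<G> \<and> range_le (int r) \<phi> \<and> range_le (int r) (inv\<^bsub>\<G>\<^esub> \<phi>)" for B
    using card_cosets_le_complexity[OF x0 rk forced, of B] that complexity_mono[OF n] by force
  moreover have "finite (occurrence_stabilizer x0 (int n))"
    using finite_occurrence_stabilizer[OF min x0] by simp
  ultimately show ?thesis using subgroup_occurrence_stabilizer by blast
qed

section \<open>Complexity below the exponential of a square root\<close>

lemma exists_common_range:
  assumes "finite S" "S \<subseteq> carrier \<G>"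
  shows "\<exists>R::nat. \<forall>\<phi>\<in>S. range_le (int R) \<phi> \<and> range_le (int R) (inv\<^bsub>\<G>\<^esub> \<phi>)"
  using assms
proof (induction S rule: finite_induct)
  case (insert \<phi> S)
  then obtain R :: nat where R: "\<forall>\<psi>\<in>S. range_le (int R) \<psi> \<and> range_le (int R) (inv\<^bsub>\<G>\<^esub> \<psi>)" by auto
  obtain r where r: "r \<ge> 0" "range_le r \<phi>" using exists_range[of \<phi>] insert.prems by auto
  obtain s where s: "s \<ge> 0" "range_le s (inv\<^bsub>\<G>\<^esub> \<phi>)"
    using exists_range[of "inv\<^bsub>\<G>\<^esub> \<phi>"] insert.prems by auto
  have mono: "range_le t \<psi> \<Longrightarrow> t \<le> int R + r + s \<Longrightarrow> range_le (int (R + nat r + nat s)) \<psi>" for t \<psi>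
    using r(1) s(1) range_le_mono by auto
  have "range_le (int (R + nat r + nat s)) \<psi> \<and> range_le (int (R + nat r + nat s)) (inv\<^bsub>\<G>\<^esub> \<psi>)"
    if "\<psi> \<in> insert \<phi> S" for \<psi>
  proof (cases "\<psi> = \<phi>")
    case True
    then show ?thesis
      using mono[OF r(2)] mono[OF s(2)] r(1) s(1) by simp
  next
    case False
    then show ?thesis
      using that R mono[of "int R"] r(1) s(1) by simp
  qed
  then show ?case by blast
qed simp

lemma range_le_word_ball:
  assumes S: "S \<subseteq> carrier \<G>" "\<forall>\<phi>\<in>S. range_le (int R) \<phi> \<and> range_le (int R) (inv\<^bsub>\<G>\<^esub> \<phi>)"
    and "\<phi> \<in> word_ball \<G> S n"
  shows "\<phi> \<in> carrier \<G> \<and> range_le (int (n * R)) \<phi> \<and> range_le (int (n * R)) (inv\<^bsub>\<G>\<^esub> \<phi>)"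
  using assms(3)
proof (induction rule: word_ball_induct)
  case (one n)
  then show ?case by (simp add: range_le_one)
next
  case (mult n \<sigma> \<phi>)
  then have \<sigma>: "\<sigma> \<in> carrier \<G>" "range_le (int R) \<sigma>" "range_le (int R) (inv\<^bsub>\<G>\<^esub> \<sigma>)" using S by auto
  have sum: "int (Suc n * R) = int R + int (n * R)" "int (Suc n * R) = int (n * R) + int R" by simp_all
  have "range_le (int (Suc n * R)) (\<sigma> \<otimes>\<^bsub>\<G>\<^esub> \<phi>)"
    unfolding sum(1) using \<sigma> mult by (intro range_le_mult) auto
  moreover have "range_le (int (Suc n * R)) (inv\<^bsub>\<G>\<^esub> \<phi> \<otimes>\<^bsub>\<G>\<^esub> inv\<^bsub>\<G>\<^esub> \<sigma>)"
    unfolding sum(2) using \<sigma> mult by (intro range_le_mult) auto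
  ultimately show ?case using \<sigma> mult by (simp add: Aut.inv_mult_group)
qed

text \<open>Products of \<open>N\<close> generators of range \<open>R\<close> have range \<open>N * R\<close>, so they are handled by a word
  forced up to distance \<open>k = 2 * N * R\<close>.  Such a word exists at a length below \<open>4 * k\<^sup>2\<close>, and the
  logarithm of the complexity at \<open>4 * k\<^sup>2\<close> is \<open>o(k) = o(N)\<close>.\<close>

lemma subexponential_modulo_finite_Aut:
  assumes min: "minimal_subshift A X"
    and slow: "\<And>\<delta>. \<delta> > 0 \<Longrightarrow>
      \<forall>\<^sub>F n in sequentially. ln (real (complexity X n)) \<le> \<delta> * sqrt (real n)"
  shows "subexponential_modulo_finite \<G>"
  unfolding subexponential_modulo_finite_def
proof (intro allI impI)
  fix S :: "((int \<Rightarrow> 'a) \<Rightarrow> int \<Rightarrow> 'a) set" and \<epsilon> :: real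
  assume S: "finite S" "S \<subseteq> carrier \<G>" and \<epsilon>: "\<epsilon> > 0"
  obtain R0 :: nat where "\<forall>\<phi>\<in>S. range_le (int R0) \<phi> \<and> range_le (int R0) (inv\<^bsub>\<G>\<^esub> \<phi>)"
    using exists_common_range[OF S] by blast
  then have R: "\<forall>\<phi>\<in>S. range_le (int (Suc R0)) \<phi> \<and> range_le (int (Suc R0)) (inv\<^bsub>\<G>\<^esub> \<phi>)"
    using range_le_mono[where s = "int (Suc R0)"] by fastforce
  define R where "R = Suc R0"
  define \<delta> where "\<delta> = min (ln 2 / 2) (\<epsilon> / (4 * real R))"
  have \<delta>: "\<delta> > 0" "\<delta> \<le> ln 2 / 2" "\<delta> \<le> \<epsilon> / (4 * real R)"
  proof -
    show "\<delta> > 0" using \<epsilon> by (simp add: \<delta>_def R_def)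
  qed (simp_all only: \<delta>_def min.cobounded1 min.cobounded2)
  have "filterlim (\<lambda>N. 4 * (2 * N * R)\<^sup>2) at_top sequentially"
  proof (rule filterlim_at_top_mono[OF filterlim_ident])
    have "N \<le> 4 * (2 * N * R)\<^sup>2" for N
    proof -
      have "N * 1 \<le> N * (N * (16 * R * R))"
        by (cases "N = 0") (simp_all add: R_def)
      then show ?thesis by (simp add: power2_eq_square algebra_simps)
    qed
    then show "\<forall>\<^sub>F N in sequentially. N \<le> 4 * (2 * N * R)\<^sup>2" by simp
  qed
  then have "\<forall>\<^sub>F N in sequentially. ln (real (complexity X (4 * (2 * N * R)\<^sup>2)))
      \<le> \<delta> * sqrt (real (4 * (2 * N * R)\<^sup>2))"
    by (rule eventually_compose_filterlim[OF slow[OF \<delta>(1)]])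
  then show "\<forall>\<^sub>F N in sequentially. \<exists>H. subgroup H \<G> \<and> finite H \<and>
      real (card (ball_cosets \<G> S N H)) \<le> exp (\<epsilon> * real N)"
    using eventually_gt_at_top[of 0]
  proof eventually_elim
    case (elim N)
    define k where "k = 2 * N * R"
    have k: "k > 0" "2 * (N * R) \<le> k" using elim(2) by (auto simp: k_def R_def)
    let ?P = "complexity X (4 * k\<^sup>2)"
    have "sqrt (real (4 * k\<^sup>2)) = 2 * real k" by (simp add: real_sqrt_mult)
    then have ln: "ln (real ?P) \<le> \<delta> * (2 * real k)" using elim(1) unfolding k_def by metis
    have pos: "?P > 0"
    proof -
      have "window 0 (4 * k\<^sup>2) ` X \<noteq> {}" using min by (simp add: minimal_subshift_def)
      then have "card (window 0 (4 * k\<^sup>2) ` X) > 0" using finite_window_image card_gt_0_iff by blast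
      then show ?thesis by (simp add: card_window_image)
    qed
    have "\<delta> * (2 * real k) \<le> ln 2 / 2 * (2 * real k)" using \<delta>(2) by (intro mult_right_mono) auto
    also have "\<dots> < real (2 * k) * ln 2" using k(1) by simp
    also have "\<dots> = ln (2 ^ (2 * k))" by (simp only: ln_realpow)
    finally have less: "ln (real ?P) < ln (2 ^ (2 * k))" using ln by linarith
    have "real ?P < 2 ^ (2 * k)"
      by (rule iffD1[OF ln_less_cancel_iff less]) (use pos in simp_all)
    then have "?P < 2 ^ (2 * k)" by (metis of_nat_less_iff of_nat_numeral of_nat_power)
    then obtain H where H: "subgroup H \<G>" "finite H"
      and few: "\<And>B. (\<forall>\<phi>\<in>B. \<phi> \<in> carrier \<G> \<and> range_le (int (N * R)) \<phi> \<and> range_le (int (N * R)) (inv\<^bsub>\<G>\<^esub> \<phi>))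
        \<Longrightarrow> card ((\<lambda>\<phi>. \<phi> <#\<^bsub>\<G>\<^esub> H) ` B) \<le> ?P"
      using exists_finite_subgroup_with_few_cosets[OF min k(2)] by blast
    have "card (ball_cosets \<G> S N H) \<le> ?P"
      unfolding ball_cosets_def using range_le_word_ball[OF S(2) R] by (intro few) (auto simp: R_def)
    also have "real ?P = exp (ln (real ?P))" using pos by simp
    also have "\<dots> \<le> exp (\<epsilon> * real N)"
    proof -
      have "\<delta> * (2 * real k) \<le> \<epsilon> / (4 * real R) * (2 * real k)" using \<delta>(3) by (intro mult_right_mono) auto
      also have "\<dots> = \<epsilon> * real N" by (simp add: k_def R_def field_simps)
      finally show ?thesis using ln by simp
    qed
    finally show ?case using H by auto
  qed
qed

end

lemma ln_le_sqrt_if_limsup_zero: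
  fixes c :: "nat \<Rightarrow> nat"
  assumes "\<beta> < 1 / 2" and lim: "limsup (\<lambda>n. ereal (ln (real (c n)) / real n powr \<beta>)) = 0"
    and "\<delta> > 0"
  shows "\<forall>\<^sub>F n in sequentially. ln (real (c n)) \<le> \<delta> * sqrt (real n)"
proof -
  have "\<forall>\<^sub>F n in sequentially. ereal (ln (real (c n)) / real n powr \<beta>) < ereal \<delta>"
    using assms by (intro Limsup_lessD) simp
  then show ?thesis
    using eventually_gt_at_top[of 0]
  proof eventually_elim
    case (elim n)
    have "ln (real (c n)) \<le> \<delta> * real n powr \<beta>"
      using elim by (simp add: pos_divide_less_eq)
    also have "\<dots> \<le> \<delta> * real n powr (1 / 2)"
      using assms elim by (intro mult_left_mono powr_mono) auto
    finally show ?case by (simp add: powr_half_sqrt)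
  qed
qed

theorem theorem1p1:
  fixes A :: "'a set" and X :: "(int \<Rightarrow> 'a) set"
  assumes "minimal_subshift A X"
    and "\<exists>\<beta>::real. \<beta> < 1 / 2 \<and>
           limsup (\<lambda>n. ereal (ln (real (complexity X n)) / real n powr \<beta>)) = 0"
  shows "amenable (Aut A X) \<and>
    (\<forall>H. subgroup H (Aut A X) \<longrightarrow>
         finitely_generated ((Aut A X)\<lparr>carrier := H\<rparr>) \<longrightarrow>
         torsion_free ((Aut A X)\<lparr>carrier := H\<rparr>) \<longrightarrow>
         subexponential_growth ((Aut A X)\<lparr>carrier := H\<rparr>))"
proof -
  interpret subshift_system A X
    using assms(1) by unfold_locales (simp add: minimal_subshift_def)
  have "subexponential_modulo_finite (Aut A X)"
    using assms ln_le_sqrt_if_limsup_zero by (intro subexponential_modulo_finite_Aut) blast+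
  then show ?thesis
    using amenable_if_subexponential_modulo_finite subexponential_growth_if_torsion_free
      Aut.group_axioms countable_Aut by blast
qed

end
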